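(* Let $0<\alpha\le2$, $d\ge2$, and let $\Omega\subseteq\mathbb{R}^d$ be Lebesgue measurable with finite measure. Then there exists a nonnegative function $R(t)$ such that for all $t\ge0$, $$\Psi^{(\alpha)}_\Omega(t)+t\left(\tfrac t2-1\right)|\Omega|=t^2\int_0^1d\lambda_1\int_{\lambda_1}^1d\lambda_2\,\Big(|\Omega|-\mathbb H^{(\alpha)}_\Omega\big(t(\lambda_2-\lambda_1)\big)\Big)+R(t),$$ and moreover: (i) for all $t\ge0$, $\dfrac{e^{-t}}{3!}T^{(3)}_\Omega(t)\le R(t)\le\dfrac{|\Omega|}{3!}t^3$; (ii) $\lim_{t\to0^+}R(t)/t^3=|\Omega|/3!$.
   Context: $\mathbf X$ is the rotationally invariant $\alpha$-stable process in $\mathbb{R}^d$ with transition densities $p^{(\alpha)}_t(x,y)=p^{(\alpha)}_t(x-y)$ determined by $\int_{\mathbb{R}^d}e^{-iy\cdot\xi}p^{(\alpha)}_t(y)dy=e^{-t|\xi|^\alpha}$. For $x,y\in\mathbb{R}^d$, $t>0$, $\mathbb{E}^t_{x,y}$ denotes expectation for the $\alpha$-stable bridge from $x$ to $y$ of length $t$, whose finite-dimensional distributions for $0<s_1<\dots<s_k<t$ are $$\mathbb{P}^t_{x,y}(X_{s_1}\in dz_1,\dots,X_{s_k}\in dz_k)=\frac{p^{(\alpha)}_{s_1}(x,z_1)\prod_{j=1}^{k-1}p^{(\alpha)}_{s_{j+1}-s_j}(z_j,z_{j+1})\,p^{(\alpha)}_{t-s_k}(z_k,y)}{p^{(\alpha)}_t(x,y)}\,dz_1\cdots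 dz_k.$$ $\Psi^{(\alpha)}_\Omega(t)=\int_{\mathbb{R}^d}dx\int_{\mathbb{R}^d}dy\,p^{(\alpha)}_t(x,y)\big(1-\mathbb{E}^t_{x,y}[e^{-\int_0^t\mathbb{1}_\Omega(X_s)ds}]\big)$. The heat content is $\mathbb H^{(\alpha)}_\Omega(t)=\int_\Omega\int_\Omega p^{(\alpha)}_t(z_1,z_2)\,dz_1dz_2$. For $k\in\mathbb N$, $T^{(k)}_\Omega(t)=\int_{\mathbb{R}^d}dx\int_{\mathbb{R}^d}dy\,p^{(\alpha)}_t(x,y)\,\mathbb{E}^t_{x,y}[(\int_0^t\mathbb{1}_\Omega(X_s)ds)^k]$. $|\Omega|$ is Lebesgue measure. *)

theory Defs
  imports "HOL-Probability.Probability"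
begin

text \<open>Transition density of the rotationally invariant alpha-stable process,
  p_t(z) = (2 pi)^(-d) * integral of cos(z . xi) exp(-t |xi|^alpha) d xi
  (Fourier inversion of exp(-t |xi|^alpha)); p_t(x,y) = p_t(x - y).\<close>
definition stable_density :: "real \<Rightarrow> real \<Rightarrow> 'a::euclidean_space \<Rightarrow> real" where
  "stable_density \<alpha> t z =
     (\<integral>\<xi>. cos (z \<bullet> \<xi>) * exp (- t * norm \<xi> powr \<alpha>) \<partial>lborel) / (2 * pi) ^ DIM('a)"

definition bridge_fdd_density ::
  "real \<Rightarrow> real \<Rightarrow> 'a::euclidean_space \<Rightarrow> 'a \<Rightarrow> nat \<Rightarrow> (nat \<Rightarrow> real) \<Rightarrow> (nat \<Rightarrow> 'a) \<Rightarrow> real" where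
  "bridge_fdd_density \<alpha> t x y k s z =
     stable_density \<alpha> (s 0) (x - z 0)
     * (\<Prod>j<k - 1. stable_density \<alpha> (s (Suc j) - s j) (z j - z (Suc j)))
     * stable_density \<alpha> (t - s (k - 1)) (z (k - 1) - y)
     / stable_density \<alpha> t (x - y)"

definition is_stable_bridge ::
  "real \<Rightarrow> real \<Rightarrow> 'a::euclidean_space \<Rightarrow> 'a \<Rightarrow> 'w measure \<Rightarrow> ('w \<Rightarrow> real \<Rightarrow> 'a) \<Rightarrow> bool" where
  "is_stable_bridge \<alpha> t x y M X \<longleftrightarrow>
     prob_space M \<and>
     (\<lambda>(\<omega>, s). X \<omega> s) \<in> borel_measurable (M \<Otimes>\<^sub>M restrict_space lborel {0..t}) \<and>
     (\<forall>\<omega>\<in>space M. X \<omega> 0 = x \<and> X \<omega> t = y) \<and>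
     (\<forall>k s. 1 \<le> k \<longrightarrow> 0 < s 0 \<longrightarrow> (\<forall>j. Suc j < k \<longrightarrow> s j < s (Suc j)) \<longrightarrow> s (k - 1) < t \<longrightarrow>
        distr M (PiM {..<k} (\<lambda>_. lborel)) (\<lambda>\<omega>. restrict (\<lambda>j. X \<omega> (s j)) {..<k})
        = density (PiM {..<k} (\<lambda>_. lborel)) (\<lambda>z. ennreal (bridge_fdd_density \<alpha> t x y k s z)))"

definition occupation_time :: "'a set \<Rightarrow> real \<Rightarrow> (real \<Rightarrow> 'a) \<Rightarrow> real" where
  "occupation_time \<Omega> t w = enn2real (\<integral>\<^sup>+ s\<in>{0..t}. indicator \<Omega> (w s) \<partial>lborel)"

definition stable_Psi ::
  "real \<Rightarrow> 'a::euclidean_space set \<Rightarrow> (real \<Rightarrow> 'a \<Rightarrow> 'a \<Rightarrow> 'w measure)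
   \<Rightarrow> (real \<Rightarrow> 'a \<Rightarrow> 'a \<Rightarrow> 'w \<Rightarrow> real \<Rightarrow> 'a) \<Rightarrow> real \<Rightarrow> real" where
  "stable_Psi \<alpha> \<Omega> B X t = enn2real
     (\<integral>\<^sup>+ x. \<integral>\<^sup>+ y. ennreal (stable_density \<alpha> t (x - y)) *
        (\<integral>\<^sup>+ \<omega>. ennreal (1 - exp (- occupation_time \<Omega> t (X t x y \<omega>))) \<partial>(B t x y)) \<partial>lborel \<partial>lborel)"

definition stable_T ::
  "nat \<Rightarrow> real \<Rightarrow> 'a::euclidean_space set \<Rightarrow> (real \<Rightarrow> 'a \<Rightarrow> 'a \<Rightarrow> 'w measure)
   \<Rightarrow> (real \<Rightarrow> 'a \<Rightarrow> 'a \<Rightarrow> 'w \<Rightarrow> real \<Rightarrow> 'a) \<Rightarrow> real \<Rightarrow> real" where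
  "stable_T k \<alpha> \<Omega> B X t = enn2real
     (\<integral>\<^sup>+ x. \<integral>\<^sup>+ y. ennreal (stable_density \<alpha> t (x - y)) *
        (\<integral>\<^sup>+ \<omega>. ennreal (occupation_time \<Omega> t (X t x y \<omega>) ^ k) \<partial>(B t x y)) \<partial>lborel \<partial>lborel)"

definition heat_content :: "real \<Rightarrow> 'a::euclidean_space set \<Rightarrow> real \<Rightarrow> real" where
  "heat_content \<alpha> \<Omega> t =
     (\<integral>x. \<integral>y. indicator \<Omega> x * indicator \<Omega> y * stable_density \<alpha> t (x - y) \<partial>lebesgue \<partial>lebesgue)"

end

theory Submission
  imports Defs
begin

text \<open>
  The existence of the bridges already makes every \<open>p\<^sub>t\<close> nowhere zero, hence positive (it is continuous,
  and positive at \<open>0\<close>), and turns the normalisation of the one-point marginals into the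
  Chapman-Kolmogorov equation, from which \<open>\<integral>p\<^sub>t = 1\<close> follows by scaling.
  Put \<open>r(l) = 1 - exp(-l) - l + l\<^sup>2/2 = exp(-c) l\<^sup>3/6\<close> with \<open>0 \<le> c \<le> l\<close>. Applying this to the occupation time
  \<open>L \<le> t\<close> gives \<open>\<Psi> = T\<^sub>1 - T\<^sub>2/2 + R\<close> with \<open>R\<close> the integral of \<open>E[r(L)]\<close>, where \<open>T\<^sub>1 = t|\<Omega>|\<close> and \<open>T\<^sub>2\<close>
  is a double time integral of the heat content. The bounds on \<open>R\<close> are those on \<open>r\<close>. For the limit,
  \<open>l(t - l)\<^sup>2 \<ge> 0\<close> gives \<open>T\<^sub>3 \<ge> 2t T\<^sub>2 - t\<^sup>2 T\<^sub>1\<close>, and the heat content tends to \<open>|\<Omega>|\<close> at time \<open>0\<close>.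
  As the bridges depend arbitrarily on their endpoints, measurability in \<open>(x, y)\<close> has to be
  read off the finite-dimensional densities of all orders.
\<close>

text \<open>The common object is the functional sending f to the integral over both endpoints of
  \<open>p t (x - y)\<close> times E[f(L)]. Its weight cancels the denominator of the bridge
  densities, so moments of L become integrals of products of transition densities, and integrating
  out x and y removes the two outer factors. The functional has values in \<open>ennreal\<close>,
  where differences are awkward and positive constants f give infinity; hence the expansion is used
  in the form (1 - exp(-l)) + l^2/2 = l + r(l), whose four terms are nonnegative and bounded by
  multiples of l on [0, t]. The triangle 0 < u < v < 1 has area 1/2, which is the origin of t^2
  |\<Omega>| / 2 on the left of the identity. The inequality for T_3 replaces a three-time
  computation: T_1 = t |\<Omega>| and T_2 / t^2 tends to |\<Omega>|, so 2 t T_2 - t^2 T_1 divided by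
  t^3 already has the limit |\<Omega>|. The set \<Omega> is replaced by a Borel subset that differs
  from it by a null set, in which a bridge almost surely spends no time.\<close>

section \<open>Symmetry and self-similarity of the Fourier integral\<close>

lemma measurable_stable_density [measurable]:
  fixes g :: "'b \<Rightarrow> 'a::euclidean_space"
  assumes [measurable]: "f \<in> borel_measurable M" "g \<in> borel_measurable M"
  shows "(\<lambda>x. stable_density \<alpha> (f x) (g x)) \<in> borel_measurable M"
  unfolding stable_density_def by measurable

lemma stable_density_minus: "stable_density \<alpha> t (- z) = stable_density \<alpha> t z"
  by (simp add: stable_density_def)

text \<open>Substituting \<open>c *\<^sub>R \<xi>\<close> for \<xi> with c = t^(-1/\<alpha>) turns t
  |\<xi>|^\<alpha> into |\<xi>|^\<alpha> and contributes the Jacobian c^d. The substitution is valid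
  for Bochner integrals whether or not they converge, so it is available before integrability is
  known.\<close>

lemma stable_density_scale:
  fixes z :: "'a::euclidean_space"
  assumes "0 < \<alpha>" "0 < t"
  shows "stable_density \<alpha> t z = t powr (- DIM('a) / \<alpha>) * stable_density \<alpha> 1 (t powr (- 1 / \<alpha>) *\<^sub>R z)"
proof -
  define c where "c = t powr (- 1 / \<alpha>)"
  have c: "c > 0" using assms by (simp add: c_def)
  have ct: "t * (c * x) powr \<alpha> = x powr \<alpha>" if "x \<ge> 0" for x
  proof -
    have "c powr \<alpha> = t powr (- 1 / \<alpha> * \<alpha>)" unfolding c_def by (rule powr_powr)
    then have "c powr \<alpha> = 1 / t" using assms by (simp add: powr_minus_divide)
    then show ?thesis using assms that c by (simp add: powr_mult)
  qed
  have "(\<integral>\<xi>. cos (z \<bullet> \<xi>) * exp (- t * norm \<xi> powr \<alpha>) \<partial>(lborel :: 'a measure))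
     = (\<integral>\<xi>. cos (z \<bullet> \<xi>) * exp (- t * norm \<xi> powr \<alpha>) \<partial>density (distr lborel borel (\<lambda>x. 0 + c *\<^sub>R x)) (\<lambda>_. \<bar>c\<bar> ^ DIM('a)))"
    using lborel_affine[of c "0 :: 'a"] c by simp
  also have "\<dots> = \<bar>c\<bar> ^ DIM('a) * (\<integral>\<xi>. cos (z \<bullet> (c *\<^sub>R \<xi>)) * exp (- t * norm (c *\<^sub>R \<xi>) powr \<alpha>) \<partial>lborel)"
    using c by (subst integral_density) (auto simp: integral_distr)
  also have "\<dots> = \<bar>c\<bar> ^ DIM('a) * (\<integral>\<xi>. cos ((c *\<^sub>R z) \<bullet> \<xi>) * exp (- 1 * norm \<xi> powr \<alpha>) \<partial>lborel)"
    using c by (simp add: ct)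
  also have "\<bar>c\<bar> ^ DIM('a) = t powr (- DIM('a) / \<alpha>)"
    using c assms by (simp add: c_def powr_powr flip: powr_realpow)
  finally show ?thesis by (simp add: stable_density_def c_def)
qed

section \<open>Positivity, semigroup property and mass of the density, read off the bridges\<close>

locale stable_bridge_family =
  fixes \<alpha> :: real and B :: "real \<Rightarrow> 'a::euclidean_space \<Rightarrow> 'a \<Rightarrow> 'w measure"
    and X :: "real \<Rightarrow> 'a \<Rightarrow> 'a \<Rightarrow> 'w \<Rightarrow> real \<Rightarrow> 'a"
  assumes \<alpha>_pos: "0 < \<alpha>"
    and bridge: "\<And>t x y. 0 < t \<Longrightarrow> is_stable_bridge \<alpha> t x y (B t x y) (X t x y)"
begin

abbreviation p :: "real \<Rightarrow> 'a \<Rightarrow> real" where "p \<equiv> stable_density \<alpha>"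

lemma prob_space_B: "0 < t \<Longrightarrow> prob_space (B t x y)"
  using bridge by (auto simp: is_stable_bridge_def)

lemma measurable_X [measurable]:
  "0 < t \<Longrightarrow> (\<lambda>(\<omega>, s). X t x y \<omega> s) \<in> borel_measurable (B t x y \<Otimes>\<^sub>M restrict_space lborel {0..t})"
  using bridge by (auto simp: is_stable_bridge_def)

lemma measurable_X_at:
  assumes "0 < t" "0 \<le> s" "s \<le> t"
  shows "(\<lambda>\<omega>. X t x y \<omega> s) \<in> borel_measurable (B t x y)"
proof -
  have "(\<lambda>\<omega>. (\<omega>, s)) \<in> B t x y \<rightarrow>\<^sub>M B t x y \<Otimes>\<^sub>M restrict_space lborel {0..t}"
    using assms by (intro measurable_Pair2') (auto simp: space_restrict_space)
  from measurable_compose[OF this measurable_X[OF assms(1)]] show ?thesis by simp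
qed

lemma distr_bridge:
  assumes "0 < t" "1 \<le> k" "0 < s 0" "\<And>j. Suc j < k \<Longrightarrow> s j < s (Suc j)" "s (k - 1) < t"
  shows "distr (B t x y) (PiM {..<k} (\<lambda>_. lborel)) (\<lambda>\<omega>. restrict (\<lambda>j. X t x y \<omega> (s j)) {..<k})
        = density (PiM {..<k} (\<lambda>_. lborel)) (\<lambda>z. ennreal (bridge_fdd_density \<alpha> t x y k s z))"
  using bridge[OF assms(1)] assms unfolding is_stable_bridge_def by blast

text \<open>The position at time s has a law of total mass one, and the case k = 1 of the bridge
  condition names its density. The sign of \<open>p\<close> is still unknown here, so the whole
  quotient stays under a single \<open>ennreal\<close>.\<close>

lemma nn_integral_bridge_density_1:
  assumes "0 < s" "s < t"
  shows "(\<integral>\<^sup>+z. ennreal (p s (x - z) * p (t - s) (z - y) / p t (x - y)) \<partial>lborel) = 1"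
proof -
  interpret B: prob_space "B t x y" using assms by (intro prob_space_B) auto
  interpret product_sigma_finite "\<lambda>_::nat. lborel :: 'a measure"
    by standard
  let ?P = "PiM {..<1} (\<lambda>_. lborel) :: (nat \<Rightarrow> 'a) measure"
  have d: "distr (B t x y) ?P (\<lambda>\<omega>. restrict (\<lambda>j. X t x y \<omega> s) {..<1})
        = density ?P (\<lambda>z. ennreal (bridge_fdd_density \<alpha> t x y 1 (\<lambda>_. s) z))"
    using assms by (intro distr_bridge) auto
  have "prob_space (distr (B t x y) ?P (\<lambda>\<omega>. restrict (\<lambda>j. X t x y \<omega> s) {..<1}))"
    using assms measurable_X_at[of t s x y] by (intro B.prob_space_distr measurable_restrict) auto
  then have "prob_space (density ?P (\<lambda>z. ennreal (bridge_fdd_density \<alpha> t x y 1 (\<lambda>_. s) z)))"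
    by (simp only: d)
  then have "1 = emeasure (density ?P (\<lambda>z. ennreal (bridge_fdd_density \<alpha> t x y 1 (\<lambda>_. s) z))) (space ?P)"
    by (metis prob_space.emeasure_space_1 space_density)
  also have "\<dots> = (\<integral>\<^sup>+z. ennreal (bridge_fdd_density \<alpha> t x y 1 (\<lambda>_. s) z) \<partial>?P)"
    unfolding bridge_fdd_density_def
    by (subst emeasure_density) (auto intro!: nn_integral_cong simp: space_PiM)
  also have "\<dots> = (\<integral>\<^sup>+z. ennreal (p s (x - z 0) * p (t - s) (z 0 - y) / p t (x - y)) \<partial>PiM {0::nat} (\<lambda>_. lborel))"
    by (simp add: bridge_fdd_density_def lessThan_Suc)
  also have "\<dots> = (\<integral>\<^sup>+z. ennreal (p s (x - z) * p (t - s) (z - y) / p t (x - y)) \<partial>lborel)"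
    by (subst product_nn_integral_singleton[where f = "\<lambda>z. ennreal (p s (x - z) * p (t - s) (z - y) / p t (x - y))"]) auto
  finally show ?thesis by simp
qed

text \<open>With a vanishing denominator the quotient in the one-point density is 0 everywhere, so
  its mass would be 0 and not 1.\<close>

lemma p_nonzero: "p t z \<noteq> 0" if "0 < t"
proof
  assume "p t z = 0"
  then show False using nn_integral_bridge_density_1[of "t/2" t z 0] that by simp
qed

text \<open>A divergent Bochner integral has the value 0, which would make \<open>p t 0\<close>
  vanish.\<close>

lemma integrable_exp: "integrable lborel (\<lambda>\<xi>::'a. exp (- t * norm \<xi> powr \<alpha>))" if "0 < t"
proof (rule ccontr)
  assume "\<not> ?thesis"
  then have "p t 0 = 0" by (simp add: stable_density_def not_integrable_integral_eq)
  then show False using p_nonzero that by blast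
qed

lemma p_le_p0: "p t z \<le> p t 0" if "0 < t"
proof -
  have "(\<integral>\<xi>. cos (z \<bullet> \<xi>) * exp (- t * norm \<xi> powr \<alpha>) \<partial>lborel)
     \<le> (\<integral>\<xi>. cos ((0::'a) \<bullet> \<xi>) * exp (- t * norm \<xi> powr \<alpha>) \<partial>lborel)"
    using integrable_exp[OF that]
    by (intro integral_mono Bochner_Integration.integrable_bound[OF integrable_exp[OF that]]) (auto simp: abs_mult)
  then show ?thesis by (simp add: stable_density_def divide_right_mono)
qed

lemma continuous_on_p: "continuous_on UNIV (p t)" if "0 < t"
proof (rule continuous_on_sequentiallyI)
  fix u :: "nat \<Rightarrow> 'a" and a assume u: "u \<longlonglongrightarrow> a"
  have "(\<lambda>n. \<integral>\<xi>. cos (u n \<bullet> \<xi>) * exp (- t * norm \<xi> powr \<alpha>) \<partial>lborel)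
      \<longlonglongrightarrow> (\<integral>\<xi>. cos (a \<bullet> \<xi>) * exp (- t * norm \<xi> powr \<alpha>) \<partial>lborel)"
    using u integrable_exp[OF that]
    by (intro integral_dominated_convergence[where w = "\<lambda>\<xi>. exp (- t * norm \<xi> powr \<alpha>)"])
       (auto intro!: tendsto_intros simp: abs_mult)
  then show "(\<lambda>n. p t (u n)) \<longlonglongrightarrow> p t a"
    unfolding stable_density_def by (intro tendsto_intros) auto
qed

lemma p_pos: "0 < p t z" if "0 < t"
proof (rule ccontr)
  assume "\<not> 0 < p t z"
  moreover have "0 \<le> p t 0" by (simp add: stable_density_def)
  moreover have "connected (range (p t))"
    using continuous_on_p[OF that] by (intro connected_continuous_image) auto
  ultimately have "0 \<in> range (p t)"
    by (meson connectedD_interval not_less rangeI)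
  then show False using p_nonzero[OF that] by (metis rangeE)
qed

lemma p_nonneg: "0 < t \<Longrightarrow> 0 \<le> p t z"
  using p_pos[of t z] by simp

lemma Chapman_Kolmogorov:
  assumes "0 < s" "0 < u"
  shows "(\<integral>\<^sup>+z. ennreal (p s (x - z)) * ennreal (p u (z - y)) \<partial>lborel) = ennreal (p (s + u) (x - y))"
proof -
  have pos: "p (s + u) (x - y) > 0" using p_pos assms by simp
  have "ennreal (p (s + u) (x - y)) = ennreal (p (s + u) (x - y)) *
      (\<integral>\<^sup>+z. ennreal (p s (x - z) * p u (z - y) / p (s + u) (x - y)) \<partial>lborel)"
    using nn_integral_bridge_density_1[of s "s + u" x y] assms by simp
  also have "\<dots> = (\<integral>\<^sup>+z. ennreal (p s (x - z)) * ennreal (p u (z - y)) \<partial>lborel)"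
    using pos assms
    by (subst nn_integral_cmult[symmetric])
       (auto intro!: nn_integral_cong simp: ennreal_mult[symmetric] p_nonneg)
  finally show ?thesis by simp
qed

text \<open>In the scaled form the prefactors cancel and the argument s^(-1/\<alpha>) z tends to 0,
  where \<open>p 1\<close> is continuous and nonzero.\<close>

lemma p_ratio_tendsto: "((\<lambda>s. p s z / p s 0) \<longlongrightarrow> 1) at_top"
proof -
  have "((\<lambda>s. p 1 (s powr (- 1 / \<alpha>) *\<^sub>R z) / p 1 0) \<longlongrightarrow> p 1 (0 *\<^sub>R z) / p 1 0) at_top"
  proof (intro tendsto_intros)
    have "((\<lambda>s. s powr (- 1 / \<alpha>) *\<^sub>R z) \<longlongrightarrow> 0 *\<^sub>R z) at_top"
      using tendsto_neg_powr[OF _ filterlim_ident, of "- 1 / \<alpha>"] \<alpha>_pos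
      by (intro tendsto_scaleR tendsto_const) simp
    then show "((\<lambda>s. p 1 (s powr (- 1 / \<alpha>) *\<^sub>R z)) \<longlongrightarrow> p 1 (0 *\<^sub>R z)) at_top"
      by (rule continuous_on_tendsto_compose[OF continuous_on_p[OF zero_less_one]]) auto
    show "p 1 0 \<noteq> 0" using p_nonzero by simp
  qed
  moreover have "\<forall>\<^sub>F s in at_top. p 1 (s powr (- 1 / \<alpha>) *\<^sub>R z) / p 1 0 = p s z / p s 0"
    using eventually_gt_at_top[of 0]
  proof eventually_elim
    case (elim s)
    then show ?case using \<alpha>_pos
      by (simp add: stable_density_scale[of \<alpha> s])
  qed
  ultimately show ?thesis using p_nonzero[of 1 0] by (simp add: tendsto_cong)
qed

text \<open>By scaling, \<open>p s 0\<close> is a constant times s^(-d/\<alpha>), so the ratio is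
  (t/s + 1)^(-d/\<alpha>).\<close>

lemma p_time_ratio_tendsto: "((\<lambda>s. p (t + s) 0 / p s 0) \<longlongrightarrow> 1) at_top" if "0 < t"
proof -
  have "((\<lambda>s. (t / s + 1) powr (- DIM('a) / \<alpha>)) \<longlongrightarrow> (0 + 1) powr (- DIM('a) / \<alpha>)) at_top"
    by (intro tendsto_intros tendsto_divide_0[OF tendsto_const] filterlim_at_top_imp_at_infinity filterlim_ident) simp
  moreover have "\<forall>\<^sub>F s in at_top. (t / s + 1) powr (- DIM('a) / \<alpha>) = p (t + s) 0 / p s 0"
    using eventually_gt_at_top[of 0]
  proof eventually_elim
    case (elim s)
    have "t / s + 1 = (t + s) / s" using elim by (simp add: field_simps)
    then show ?case using \<alpha>_pos elim that p_nonzero[of 1 0]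
      by (simp add: stable_density_scale[of \<alpha> s] stable_density_scale[of \<alpha> "t + s"] powr_divide)
  qed
  ultimately show ?thesis by (simp add: tendsto_cong)
qed

text \<open>By Chapman-Kolmogorov the integral of \<open>p t z * p s z / p s 0\<close> over \<open>z\<close> is
  \<open>p (t + s) 0 / p s 0\<close>; let \<open>s\<close> tend to infinity.\<close>

lemma nn_integral_p: "(\<integral>\<^sup>+z. ennreal (p t z) \<partial>lborel) = 1" if t: "0 < t"
proof -
  define f where "f n z = ennreal (p t z * (p (real (Suc n)) z / p (real (Suc n)) 0))" for n and z :: 'a
  have lim: "filterlim (\<lambda>n. real (Suc n)) at_top sequentially"
    by (intro filterlim_compose[OF filterlim_real_sequentially] filterlim_Suc)
  have f_int: "(\<integral>\<^sup>+z. f n z \<partial>lborel) = ennreal (p (t + real (Suc n)) 0 / p (real (Suc n)) 0)" for n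
  proof -
    have "(\<integral>\<^sup>+z. f n z \<partial>lborel)
        = (\<integral>\<^sup>+z. ennreal (p t (0 - z)) * ennreal (p (real (Suc n)) (z - 0)) / ennreal (p (real (Suc n)) 0) \<partial>lborel)"
      using t by (intro nn_integral_cong)
        (simp add: f_def stable_density_minus ennreal_mult[symmetric] divide_ennreal p_nonneg p_pos mult_nonneg_nonneg)
    also have "\<dots> = ennreal (p (t + real (Suc n)) 0) / ennreal (p (real (Suc n)) 0)"
      using Chapman_Kolmogorov[of t "real (Suc n)" 0 0] t by (subst nn_integral_divide) auto
    also have "\<dots> = ennreal (p (t + real (Suc n)) 0 / p (real (Suc n)) 0)"
      using t by (intro divide_ennreal) (auto simp: p_nonneg p_pos)
    finally show ?thesis .
  qed
  have f_lim: "(\<lambda>n. f n z) \<longlonglongrightarrow> ennreal (p t z)" for z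
    unfolding f_def using tendsto_mult[OF tendsto_const[of "p t z"] filterlim_compose[OF p_ratio_tendsto lim]]
    by (intro tendsto_ennrealI) simp
  have i_lim: "(\<lambda>n. \<integral>\<^sup>+z. f n z \<partial>lborel) \<longlonglongrightarrow> 1"
    unfolding f_int using tendsto_ennrealI[OF filterlim_compose[OF p_time_ratio_tendsto[OF t] lim]] by simp
  have [measurable]: "f n \<in> borel_measurable lborel" for n
    unfolding f_def by measurable
  \<comment> \<open>Dominated convergence would need \<open>p t\<close> to be integrable, which is
    part of the claim. Fatou gives the upper bound 1; the bound \<open>f n\<close> \<le>
    \<open>p t\<close>, from \<open>p_le_p0\<close>, gives the lower one.\<close>
  have "(\<integral>\<^sup>+z. ennreal (p t z) \<partial>lborel) = (\<integral>\<^sup>+z. liminf (\<lambda>n. f n z) \<partial>lborel)"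
    using f_lim by (intro nn_integral_cong) (metis lim_imp_Liminf trivial_limit_sequentially)
  also have "\<dots> \<le> liminf (\<lambda>n. \<integral>\<^sup>+z. f n z \<partial>lborel)"
    by (intro nn_integral_liminf) auto
  also have "\<dots> = 1" using i_lim by (metis lim_imp_Liminf trivial_limit_sequentially)
  finally have le: "(\<integral>\<^sup>+z. ennreal (p t z) \<partial>lborel) \<le> 1" .
  have "f n z \<le> ennreal (p t z)" for n z
    unfolding f_def using t p_le_p0[of "real (Suc n)" z] p_pos[of "real (Suc n)" 0]
    by (intro ennreal_leI mult_left_le) (auto simp: p_nonneg)
  then have "(\<integral>\<^sup>+z. f n z \<partial>lborel) \<le> (\<integral>\<^sup>+z. ennreal (p t z) \<partial>lborel)" for n
    by (intro nn_integral_mono) auto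
  then have "1 \<le> (\<integral>\<^sup>+z. ennreal (p t z) \<partial>lborel)"
    by (intro LIMSEQ_le_const2[OF i_lim]) auto
  with le show ?thesis by (rule antisym)
qed

section \<open>Finite-dimensional laws of the bridge without the denominator\<close>

text \<open>The numerator of \<open>bridge_fdd_density\<close>; the denominator is cancelled by the
  weight \<open>p t (x - y)\<close> in the functionals.\<close>

definition fdd :: "real \<Rightarrow> 'a \<Rightarrow> 'a \<Rightarrow> nat \<Rightarrow> (nat \<Rightarrow> real) \<Rightarrow> (nat \<Rightarrow> 'a) \<Rightarrow> real" where
  "fdd t x y k s z = p (s 0) (x - z 0) * (\<Prod>j<k - 1. p (s (Suc j) - s j) (z j - z (Suc j)))
     * p (t - s (k - 1)) (z (k - 1) - y)"

text \<open>The parameter \<open>v\<close> carries endpoints and times together, so the same lemma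
  serves fixed data (a one-point parameter space) and joint measurability in endpoints and
  times.\<close>

lemma measurable_fdd:
  assumes "1 \<le> k" and [measurable]: "f \<in> borel_measurable N" "g \<in> borel_measurable N"
    and [measurable]: "\<And>j. j < k \<Longrightarrow> S j \<in> borel_measurable N"
  shows "(\<lambda>(v, z). fdd t (f v) (g v) k (\<lambda>j. S j v) z) \<in> borel_measurable (N \<Otimes>\<^sub>M PiM {..<k} (\<lambda>_. lborel))"
proof -
  have [measurable]: "(\<lambda>w. snd w j) \<in> borel_measurable (N \<Otimes>\<^sub>M PiM {..<k} (\<lambda>_. lborel :: 'a measure))" if "j < k" for j
  proof -
    have "(\<lambda>z. z j) \<in> PiM {..<k} (\<lambda>_. lborel :: 'a measure) \<rightarrow>\<^sub>M lborel"
      using that by (intro measurable_component_singleton) auto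
    then have "(\<lambda>z. z j) \<in> borel_measurable (PiM {..<k} (\<lambda>_. lborel :: 'a measure))" by simp
    then show ?thesis by (rule measurable_compose[OF measurable_snd])
  qed
  have [measurable]: "(\<lambda>w. \<Prod>j<k - 1. p (S (Suc j) (fst w) - S j (fst w)) (snd w j - snd w (Suc j)))
     \<in> borel_measurable (N \<Otimes>\<^sub>M PiM {..<k} (\<lambda>_. lborel))"
  proof (rule borel_measurable_prod)
    fix j assume "j \<in> {..<k - 1}"
    then have [simp]: "j < k" "Suc j < k" by auto
    show "(\<lambda>w. p (S (Suc j) (fst w) - S j (fst w)) (snd w j - snd w (Suc j)))
      \<in> borel_measurable (N \<Otimes>\<^sub>M PiM {..<k} (\<lambda>_. lborel))"
      by measurable
  qed
  have [simp]: "0 < k" "k - 1 < k" using assms(1) by auto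
  show ?thesis unfolding fdd_def case_prod_beta' by measurable
qed

lemma bridge_prob:
  assumes t: "0 < t" "1 \<le> k" "0 < s 0" "\<And>j. Suc j < k \<Longrightarrow> s j < s (Suc j)" "s (k - 1) < t"
    and A [measurable]: "A \<in> sets borel"
  shows "ennreal (p t (x - y)) * emeasure (B t x y) {\<omega> \<in> space (B t x y). \<forall>j<k. X t x y \<omega> (s j) \<in> A}
     = (\<integral>\<^sup>+z. (\<Prod>j<k. indicator A (z j)) * ennreal (fdd t x y k s z) \<partial>PiM {..<k} (\<lambda>_. lborel))"
proof -
  let ?P = "PiM {..<k} (\<lambda>_. lborel) :: (nat \<Rightarrow> 'a) measure"
  let ?Z = "{z \<in> space ?P. \<forall>j<k. z j \<in> A}"
  \<comment> \<open>Only neighbouring times are compared in the hypothesis; monotonicity places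
    every \<open>s j\<close> between \<open>s 0\<close> > 0 and \<open>s (k - 1)\<close> < t, where
    the path is measurable.\<close>
  have s_mono: "s i \<le> s j" if "i \<le> j" "j < k" for i j
    using that by (induction j rule: dec_induct) (use t(4) in \<open>auto intro: order_trans less_imp_le\<close>)
  have s_range: "0 \<le> s j \<and> s j \<le> t" if "j < k" for j
    using s_mono[of 0 j] s_mono[of j "k - 1"] that t by force
  have meas: "(\<lambda>\<omega>. restrict (\<lambda>j. X t x y \<omega> (s j)) {..<k}) \<in> B t x y \<rightarrow>\<^sub>M ?P"
    using s_range t by (intro measurable_restrict) (auto intro: measurable_X_at)
  have comp: "(\<lambda>z. z j) \<in> borel_measurable ?P" if "j < k" for j
    using measurable_component_singleton[of j "{..<k}" "\<lambda>_. lborel :: 'a measure"] that by simp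
  have Z [measurable]: "?Z \<in> sets ?P"
  proof -
    have "{z \<in> space ?P. z j \<in> A} \<in> sets ?P" if "j \<in> {..<k}" for j
      using measurable_sets[OF comp A, of j] that by (simp add: vimage_def Int_def conj_commute)
    then have "{z \<in> space ?P. \<forall>j\<in>{..<k}. z j \<in> A} \<in> sets ?P"
      by (intro sets.sets_Collect_finite_All) auto
    then show ?thesis by (simp only: Ball_def lessThan_iff)
  qed
  have fdd_meas [measurable]: "fdd t x y k s \<in> borel_measurable ?P"
    using measurable_compose[OF measurable_Pair1'[of "()" "count_space UNIV"]
      measurable_fdd[of k "\<lambda>_. x" "count_space UNIV" "\<lambda>_. y" "\<lambda>j _. s j"]] t(2) by simp
  have dens: "bridge_fdd_density \<alpha> t x y k s z = fdd t x y k s z / p t (x - y)" for z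
    by (simp add: bridge_fdd_density_def fdd_def)
  have pos: "0 < p t (x - y)" using t p_pos by simp
  have fdd_nonneg: "0 \<le> fdd t x y k s z" for z
    unfolding fdd_def using t by (intro mult_nonneg_nonneg prod_nonneg) (auto intro!: p_nonneg)
  have "{\<omega> \<in> space (B t x y). \<forall>j<k. X t x y \<omega> (s j) \<in> A}
    = (\<lambda>\<omega>. restrict (\<lambda>j. X t x y \<omega> (s j)) {..<k}) -` ?Z \<inter> space (B t x y)"
    by (auto simp: space_PiM)
  then have "emeasure (B t x y) {\<omega> \<in> space (B t x y). \<forall>j<k. X t x y \<omega> (s j) \<in> A}
     = emeasure (distr (B t x y) ?P (\<lambda>\<omega>. restrict (\<lambda>j. X t x y \<omega> (s j)) {..<k})) ?Z"
    using meas Z by (simp add: emeasure_distr)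
  also have "\<dots> = emeasure (density ?P (\<lambda>z. ennreal (bridge_fdd_density \<alpha> t x y k s z))) ?Z"
    using distr_bridge[of t k s x y] t by simp
  also have "\<dots> = (\<integral>\<^sup>+z. ennreal (fdd t x y k s z / p t (x - y)) * indicator ?Z z \<partial>?P)"
    unfolding dens by (subst emeasure_density) auto
  finally have "ennreal (p t (x - y)) * emeasure (B t x y) {\<omega> \<in> space (B t x y). \<forall>j<k. X t x y \<omega> (s j) \<in> A}
      = (\<integral>\<^sup>+z. ennreal (p t (x - y)) * (ennreal (fdd t x y k s z / p t (x - y)) * indicator ?Z z) \<partial>?P)"
    by (simp add: nn_integral_cmult)
  also have "\<dots> = (\<integral>\<^sup>+z. (\<Prod>j<k. indicator A (z j)) * ennreal (fdd t x y k s z) \<partial>?P)"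
  proof (intro nn_integral_cong)
    fix z assume z: "z \<in> space ?P"
    have "indicator ?Z z = (\<Prod>j<k. indicator A (z j) :: ennreal)"
      using z by (auto simp: indicator_def of_bool_def prod_zero_iff)
    then show "ennreal (p t (x - y)) * (ennreal (fdd t x y k s z / p t (x - y)) * indicator ?Z z)
       = (\<Prod>j<k. indicator A (z j)) * ennreal (fdd t x y k s z)"
      using pos fdd_nonneg[of z] by (simp add: mult.assoc[symmetric] ennreal_mult[symmetric] mult.commute)
  qed
  finally show ?thesis .
qed

section \<open>Occupation times and their moments as integrals over sampling times\<close>

text \<open>The interval is open because finite-dimensional densities exist only for times strictly
  between 0 and t.\<close>

definition time_measure :: "real \<Rightarrow> real measure" where
  "time_measure t = restrict_space lborel {0<..<t}"

lemma space_time_measure [simp]: "space (time_measure t) = {0<..<t}"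
  by (simp add: time_measure_def space_restrict_space)

lemma finite_measure_time_measure: "finite_measure (time_measure t)"
  unfolding time_measure_def
  by (rule finite_measureI) (cases "0 \<le> t"; simp add: space_restrict_space emeasure_restrict_space)

lemma measurable_time_measure [measurable]: "(\<lambda>s. s) \<in> borel_measurable (time_measure t)"
  unfolding time_measure_def by (simp add: measurable_restrict_space1)

lemma nn_integral_time_measure:
  assumes "f \<in> borel_measurable borel"
  shows "(\<integral>\<^sup>+s. f s \<partial>time_measure t) = (\<integral>\<^sup>+s. f s * indicator {0<..<t} s \<partial>lborel)"
  unfolding time_measure_def by (subst nn_integral_restrict_space) auto

text \<open>The two endpoints are null. Arbitrary integrands are covered because
  \<open>occupation_time\<close> is also rewritten for a Lebesgue set, whose indicator along a path
  need not be Borel measurable.\<close>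

lemma nn_integral_time_measure_closed: "(\<integral>\<^sup>+s\<in>{0..t}. f s \<partial>lborel) = (\<integral>\<^sup>+s. f s \<partial>time_measure t)"
proof -
  have "AE s in lborel. s \<noteq> 0 \<and> s \<noteq> t"
    using AE_lborel_singleton[of 0] AE_lborel_singleton[of t] by eventually_elim auto
  then have "AE s in lborel. f s * indicator {0..t} s = f s * indicator {0<..<t} s"
    by eventually_elim (auto simp: indicator_def)
  then have "(\<integral>\<^sup>+s\<in>{0..t}. f s \<partial>lborel) = (\<integral>\<^sup>+s. f s * indicator {0<..<t} s \<partial>lborel)"
    by (rule nn_integral_cong_AE)
  then show ?thesis
    unfolding time_measure_def by (subst nn_integral_restrict_space) auto
qed

text \<open>The \<open>ennreal\<close> version of \<open>occupation_time\<close>, to which Tonelli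
  and series apply directly. Being at most t it is finite, so both versions carry the same
  information.\<close>

definition occ :: "real \<Rightarrow> 'a \<Rightarrow> 'a \<Rightarrow> 'a set \<Rightarrow> 'w \<Rightarrow> ennreal" where
  "occ t x y A \<omega> = (\<integral>\<^sup>+s. indicator A (X t x y \<omega> s) \<partial>time_measure t)"

lemma occupation_time_eq: "occupation_time A t (X t x y \<omega>) = enn2real (occ t x y A \<omega>)"
  by (simp add: occupation_time_def occ_def nn_integral_time_measure_closed)

lemma measurable_X_time_measure:
  assumes "0 < t"
  shows "(\<lambda>(\<omega>, s). X t x y \<omega> s) \<in> borel_measurable (B t x y \<Otimes>\<^sub>M time_measure t)"
proof -
  have "(\<lambda>s. s) \<in> time_measure t \<rightarrow>\<^sub>M restrict_space lborel {0..t}"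
    unfolding time_measure_def by (intro measurable_restrict_space2 measurable_restrict_space1) (auto simp: space_restrict_space)
  then have "(\<lambda>w. (fst w, snd w)) \<in> B t x y \<Otimes>\<^sub>M time_measure t \<rightarrow>\<^sub>M B t x y \<Otimes>\<^sub>M restrict_space lborel {0..t}"
    by measurable
  from measurable_compose[OF this measurable_X[OF assms]] show ?thesis by (simp add: case_prod_beta')
qed

lemma measurable_occ:
  assumes "0 < t" and [measurable]: "A \<in> sets borel"
  shows "occ t x y A \<in> borel_measurable (B t x y)"
proof -
  interpret T: finite_measure "time_measure t" by (rule finite_measure_time_measure)
  note [measurable] = measurable_X_time_measure[OF assms(1)]
  show ?thesis unfolding occ_def by measurable
qed

lemma occ_power:
  assumes "0 < t" and A [measurable]: "A \<in> sets borel" and \<omega>: "\<omega> \<in> space (B t x y)"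
  shows "occ t x y A \<omega> ^ k = (\<integral>\<^sup>+s. (\<Prod>i<k. indicator A (X t x y \<omega> (s i))) \<partial>PiM {..<k} (\<lambda>_. time_measure t))"
proof -
  interpret T: finite_measure "time_measure t" by (rule finite_measure_time_measure)
  interpret product_sigma_finite "\<lambda>_::nat. time_measure t" by standard
  have [measurable]: "(\<lambda>s. X t x y \<omega> s) \<in> borel_measurable (time_measure t)"
    using measurable_Pair2[OF measurable_X_time_measure[OF assms(1)] \<omega>] by simp
  show ?thesis
    by (subst product_nn_integral_prod) (auto simp: occ_def)
qed

text \<open>Tonelli exchanges path and times in \<open>occ_power\<close>, and the product of the
  indicators is the indicator of the event that all sampled positions lie in A. The sampling times
  come unordered and possibly equal, whereas the bridge densities require strictly increasing
  ones.\<close>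

lemma nn_integral_occ_power:
  assumes t: "0 < t" and A [measurable]: "A \<in> sets borel"
  shows "(\<integral>\<^sup>+\<omega>. occ t x y A \<omega> ^ k \<partial>B t x y)
    = (\<integral>\<^sup>+s. emeasure (B t x y) {\<omega> \<in> space (B t x y). \<forall>i<k. X t x y \<omega> (s i) \<in> A} \<partial>PiM {..<k} (\<lambda>_. time_measure t))"
proof -
  interpret T: finite_measure "time_measure t" by (rule finite_measure_time_measure)
  interpret B: prob_space "B t x y" using t by (rule prob_space_B)
  interpret product_sigma_finite "\<lambda>_::nat. time_measure t" by standard
  interpret S: sigma_finite_measure "PiM {..<k} (\<lambda>_. time_measure t)"
    by (rule sigma_finite) auto
  interpret pair_sigma_finite "B t x y" "PiM {..<k} (\<lambda>_. time_measure t)" ..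
  have X_meas: "(\<lambda>(\<omega>, s). X t x y \<omega> (s i)) \<in> borel_measurable (B t x y \<Otimes>\<^sub>M PiM {..<k} (\<lambda>_. time_measure t))" if "i < k" for i
  proof -
    have "(\<lambda>s. s i) \<in> PiM {..<k} (\<lambda>_. time_measure t) \<rightarrow>\<^sub>M time_measure t"
      using that by (intro measurable_component_singleton) auto
    then have "(\<lambda>w. (fst w, snd w i)) \<in> B t x y \<Otimes>\<^sub>M PiM {..<k} (\<lambda>_. time_measure t) \<rightarrow>\<^sub>M B t x y \<Otimes>\<^sub>M time_measure t"
      by measurable
    from measurable_compose[OF this measurable_X_time_measure[OF t]] show ?thesis by (simp add: case_prod_beta')
  qed
  have ind_meas: "(\<lambda>(\<omega>, s). \<Prod>i<k. indicator A (X t x y \<omega> (s i)) :: ennreal)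
      \<in> borel_measurable (B t x y \<Otimes>\<^sub>M PiM {..<k} (\<lambda>_. time_measure t))"
    unfolding case_prod_beta'
  proof (rule borel_measurable_prod_ennreal)
    fix i assume "i \<in> {..<k}"
    then have "(\<lambda>w. X t x y (fst w) (snd w i)) \<in> borel_measurable (B t x y \<Otimes>\<^sub>M PiM {..<k} (\<lambda>_. time_measure t))"
      using X_meas[of i] by (simp add: case_prod_beta')
    then show "(\<lambda>w. indicator A (X t x y (fst w) (snd w i)) :: ennreal)
      \<in> borel_measurable (B t x y \<Otimes>\<^sub>M PiM {..<k} (\<lambda>_. time_measure t))" by measurable
  qed
  have "(\<integral>\<^sup>+\<omega>. occ t x y A \<omega> ^ k \<partial>B t x y)
     = (\<integral>\<^sup>+\<omega>. \<integral>\<^sup>+s. (\<Prod>i<k. indicator A (X t x y \<omega> (s i))) \<partial>PiM {..<k} (\<lambda>_. time_measure t) \<partial>B t x y)"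
    by (intro nn_integral_cong occ_power t A)
  also have "\<dots> = (\<integral>\<^sup>+s. \<integral>\<^sup>+\<omega>. (\<Prod>i<k. indicator A (X t x y \<omega> (s i))) \<partial>B t x y \<partial>PiM {..<k} (\<lambda>_. time_measure t))"
    by (rule Fubini'[symmetric, OF ind_meas])
  also have "\<dots> = (\<integral>\<^sup>+s. emeasure (B t x y) {\<omega> \<in> space (B t x y). \<forall>i<k. X t x y \<omega> (s i) \<in> A} \<partial>PiM {..<k} (\<lambda>_. time_measure t))"
  proof (intro nn_integral_cong)
    fix s assume s: "s \<in> space (PiM {..<k} (\<lambda>_. time_measure t))"
    have "{\<omega> \<in> space (B t x y). \<forall>i<k. X t x y \<omega> (s i) \<in> A} \<in> sets (B t x y)"
    proof -
      have "(\<lambda>\<omega>. X t x y \<omega> (s i)) \<in> borel_measurable (B t x y)" if "i \<in> {..<k}" for i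
        using s that t by (intro measurable_X_at) (auto simp: space_PiM PiE_iff less_imp_le)
      then have "{\<omega> \<in> space (B t x y). X t x y \<omega> (s i) \<in> A} \<in> sets (B t x y)" if "i \<in> {..<k}" for i
        using measurable_sets[OF _ A, of "\<lambda>\<omega>. X t x y \<omega> (s i)"] that by (simp add: vimage_def Int_def conj_commute)
      then have "{\<omega> \<in> space (B t x y). \<forall>i\<in>{..<k}. X t x y \<omega> (s i) \<in> A} \<in> sets (B t x y)"
        by (rule sets.sets_Collect_finite_All) (assumption, simp)
      then show ?thesis by (simp only: Ball_def lessThan_iff)
    qed
    then have "emeasure (B t x y) {\<omega> \<in> space (B t x y). \<forall>i<k. X t x y \<omega> (s i) \<in> A}
       = (\<integral>\<^sup>+\<omega>. indicator {\<omega> \<in> space (B t x y). \<forall>i<k. X t x y \<omega> (s i) \<in> A} \<omega> \<partial>B t x y)"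
      by (rule nn_integral_indicator[symmetric])
    also have "\<dots> = (\<integral>\<^sup>+\<omega>. (\<Prod>i<k. indicator A (X t x y \<omega> (s i))) \<partial>B t x y)"
      by (intro nn_integral_cong) (auto simp: indicator_def of_bool_def prod_zero_iff)
    finally show "(\<integral>\<^sup>+\<omega>. (\<Prod>i<k. indicator A (X t x y \<omega> (s i))) \<partial>B t x y)
       = emeasure (B t x y) {\<omega> \<in> space (B t x y). \<forall>i<k. X t x y \<omega> (s i) \<in> A}" ..
  qed
  finally show ?thesis .
qed

end

section \<open>Sorting the sampling times; joint measurability of the moments in the
  endpoints\<close>

text \<open>List the distinct values of \<open>s\<close> in increasing order and let
  \<open>\<pi> j\<close> be some index attaining the j-th of them; ties make the list shorter than
  k. Taking \<open>\<pi>\<close> extensional leaves only finitely many candidates, over which a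
  measurable supremum can be formed.\<close>

lemma ex_strict_sorting:
  fixes s :: "nat \<Rightarrow> 'b::linorder"
  assumes "1 \<le> k"
  obtains m \<pi> where "1 \<le> m" "m \<le> k" "\<pi> \<in> {..<m} \<rightarrow>\<^sub>E {..<k}"
    "\<And>j. Suc j < m \<Longrightarrow> s (\<pi> j) < s (\<pi> (Suc j))" "\<And>i. i < k \<Longrightarrow> \<exists>j<m. s i = s (\<pi> j)"
proof -
  define xs where "xs = sorted_list_of_set (s ` {..<k})"
  have xs: "set xs = s ` {..<k}" "sorted_wrt (<) xs"
    by (simp_all add: xs_def)
  have "length xs = card (s ` {..<k})" by (simp add: xs_def)
  then have len: "length xs \<le> k" using card_image_le[of "{..<k}" s] by simp
  have "xs \<noteq> []" using xs(1) assms by (auto simp: lessThan_empty_iff)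
  then have len1: "1 \<le> length xs" by (cases xs) auto
  define \<pi> where "\<pi> = restrict (\<lambda>j. SOME i. i < k \<and> s i = xs ! j) {..<length xs}"
  have \<pi>: "\<pi> j < k \<and> s (\<pi> j) = xs ! j" if "j < length xs" for j
  proof -
    have "xs ! j \<in> s ` {..<k}" using that xs(1) nth_mem by blast
    then have "\<exists>i. i < k \<and> s i = xs ! j" by auto
    from someI_ex[OF this] show ?thesis using that by (simp add: \<pi>_def)
  qed
  show ?thesis
  proof (rule that[OF len1 len])
    show "\<pi> \<in> {..<length xs} \<rightarrow>\<^sub>E {..<k}"
      using \<pi> by (auto simp: PiE_iff) (simp add: \<pi>_def)
    show "s (\<pi> j) < s (\<pi> (Suc j))" if "Suc j < length xs" for j
      using that \<pi>[of j] \<pi>[of "Suc j"] xs(2) by (simp add: sorted_wrt_nth_less)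
    show "\<exists>j<length xs. s i = s (\<pi> j)" if "i < k" for i
    proof -
      have "s i \<in> set xs" using that xs(1) by auto
      then obtain j where "j < length xs" "xs ! j = s i" by (auto simp: in_set_conv_nth)
      then show ?thesis using \<pi>[of j] by auto
    qed
  qed
qed

context stable_bridge_family
begin

definition occ_moment :: "real \<Rightarrow> 'a set \<Rightarrow> nat \<Rightarrow> 'a \<Rightarrow> 'a \<Rightarrow> ennreal" where
  "occ_moment t A k x y = ennreal (p t (x - y)) * (\<integral>\<^sup>+\<omega>. occ t x y A \<omega> ^ k \<partial>B t x y)"

definition fdd_int :: "real \<Rightarrow> 'a set \<Rightarrow> nat \<Rightarrow> 'a \<Rightarrow> 'a \<Rightarrow> (nat \<Rightarrow> real) \<Rightarrow> ennreal" where
  "fdd_int t A k x y s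
    = (\<integral>\<^sup>+z. (\<Prod>j<k. indicator A (z j)) * ennreal (fdd t x y k s z) \<partial>PiM {..<k} (\<lambda>_. lborel))"

lemma measurable_fdd_int:
  assumes "1 \<le> k" "f \<in> borel_measurable N" "g \<in> borel_measurable N"
    and "\<And>j. j < k \<Longrightarrow> S j \<in> borel_measurable N" and A [measurable]: "A \<in> sets borel"
  shows "(\<lambda>v. fdd_int t A k (f v) (g v) (\<lambda>j. S j v)) \<in> borel_measurable N"
proof -
  interpret product_sigma_finite "\<lambda>_::nat. lborel :: 'a measure" by standard
  interpret P: sigma_finite_measure "PiM {..<k} (\<lambda>_. lborel :: 'a measure)"
    by (rule sigma_finite) auto
  have comp: "(\<lambda>w. snd w j) \<in> borel_measurable (N \<Otimes>\<^sub>M PiM {..<k} (\<lambda>_. lborel :: 'a measure))" if "j < k" for j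
  proof -
    have "(\<lambda>z. z j) \<in> borel_measurable (PiM {..<k} (\<lambda>_. lborel :: 'a measure))"
      using measurable_component_singleton[of j "{..<k}" "\<lambda>_. lborel :: 'a measure"] that by simp
    then show ?thesis by (rule measurable_compose[OF measurable_snd])
  qed
  have [measurable]: "(\<lambda>w. \<Prod>j<k. indicator A (snd w j) :: ennreal) \<in> borel_measurable (N \<Otimes>\<^sub>M PiM {..<k} (\<lambda>_. lborel))"
  proof (rule borel_measurable_prod_ennreal)
    fix j assume "j \<in> {..<k}"
    then have [measurable]: "(\<lambda>w. snd w j) \<in> borel_measurable (N \<Otimes>\<^sub>M PiM {..<k} (\<lambda>_. lborel :: 'a measure))"
      using comp by simp
    show "(\<lambda>w. indicator A (snd w j) :: ennreal) \<in> borel_measurable (N \<Otimes>\<^sub>M PiM {..<k} (\<lambda>_. lborel))"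
      by measurable
  qed
  have [measurable]: "(\<lambda>w. fdd t (f (fst w)) (g (fst w)) k (\<lambda>j. S j (fst w)) (snd w))
      \<in> borel_measurable (N \<Otimes>\<^sub>M PiM {..<k} (\<lambda>_. lborel))"
    using measurable_fdd[of k f N g S t] assms by (simp add: case_prod_beta')
  show ?thesis unfolding fdd_int_def
    by (rule P.borel_measurable_nn_integral) (simp add: case_prod_beta')
qed

text \<open>All maps \<open>\<pi>\<close> that sort the times give the same value, so the supremum merely selects it,
  jointly measurably in the times and the endpoints; repeated times lower the order \<open>m\<close>.\<close>

lemma prob_eq_SUP:
  assumes t: "0 < t" and k: "1 \<le> k" and A: "A \<in> sets borel" and s: "\<And>i. i < k \<Longrightarrow> s i \<in> {0<..<t}"
  shows "ennreal (p t (x - y)) * emeasure (B t x y) {\<omega> \<in> space (B t x y). \<forall>i<k. X t x y \<omega> (s i) \<in> A}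
    = (SUP (m, \<pi>) \<in> Sigma {1..k} (\<lambda>m. {..<m} \<rightarrow>\<^sub>E {..<k}).
        if (\<forall>j\<in>{..<m - 1}. s (\<pi> j) < s (\<pi> (Suc j))) \<and> (\<forall>i\<in>{..<k}. \<exists>j\<in>{..<m}. s i = s (\<pi> j))
        then fdd_int t A m x y (\<lambda>j. s (\<pi> j)) else 0)" (is "?v = (SUP (m, \<pi>) \<in> ?I. if ?C m \<pi> then ?G m \<pi> else 0)")
proof -
  have eq: "?G m \<pi> = ?v" if I: "(m, \<pi>) \<in> ?I" and C: "?C m \<pi>" for m \<pi>
  proof -
    have m: "1 \<le> m" and \<pi>: "\<And>j. j < m \<Longrightarrow> \<pi> j < k" using I by auto
    have "?G m \<pi> = ennreal (p t (x - y)) * emeasure (B t x y) {\<omega> \<in> space (B t x y). \<forall>j<m. X t x y \<omega> (s (\<pi> j)) \<in> A}"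
      unfolding fdd_int_def using t m A C s[OF \<pi>[of 0]] s[OF \<pi>[of "m - 1"]]
      by (intro bridge_prob[symmetric]) auto
    also have "{\<omega> \<in> space (B t x y). \<forall>j<m. X t x y \<omega> (s (\<pi> j)) \<in> A}
       = {\<omega> \<in> space (B t x y). \<forall>i<k. X t x y \<omega> (s i) \<in> A}"
    proof (intro Collect_cong conj_cong refl iffI allI impI)
      fix \<omega> i assume *: "\<forall>j<m. X t x y \<omega> (s (\<pi> j)) \<in> A" "i < k"
      then obtain j where "j < m" "s i = s (\<pi> j)" using C by (meson lessThan_iff)
      then show "X t x y \<omega> (s i) \<in> A" using * by simp
    next
      fix \<omega> j assume "\<forall>i<k. X t x y \<omega> (s i) \<in> A" "j < m"
      then show "X t x y \<omega> (s (\<pi> j)) \<in> A" using \<pi> by simp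
    qed
    finally show ?thesis .
  qed
  \<comment> \<open>At least one candidate passes the test, so the supremum is not merely the
    default value 0.\<close>
  obtain m \<pi> where mp: "1 \<le> m" "m \<le> k" "\<pi> \<in> {..<m} \<rightarrow>\<^sub>E {..<k}"
    "\<And>j. Suc j < m \<Longrightarrow> s (\<pi> j) < s (\<pi> (Suc j))" "\<And>i. i < k \<Longrightarrow> \<exists>j<m. s i = s (\<pi> j)"
    using ex_strict_sorting[OF k, of s] by metis
  show ?thesis
  proof (rule antisym)
    have I: "(m, \<pi>) \<in> ?I" using mp by auto
    have C: "?C m \<pi>" using mp(4,5) by (simp add: Bex_def)
    show "?v \<le> (SUP (m, \<pi>) \<in> ?I. if ?C m \<pi> then ?G m \<pi> else 0)"
      by (rule SUP_upper2[OF I]) (simp only: prod.case if_P[OF C] eq[OF I C] order_refl)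
    show "(SUP (m, \<pi>) \<in> ?I. if ?C m \<pi> then ?G m \<pi> else 0) \<le> ?v"
    proof (rule SUP_least)
      fix i assume "i \<in> ?I"
      then show "(case i of (m, \<pi>) \<Rightarrow> if ?C m \<pi> then ?G m \<pi> else 0) \<le> ?v"
        using eq by (cases i) (simp split: if_split)
    qed
  qed
qed

text \<open>For given times the weighted probability is, by \<open>prob_eq_SUP\<close>, a finite
  supremum of functions jointly measurable in endpoints and times; integrating the times away keeps
  measurability in the endpoints.\<close>

lemma measurable_occ_moment:
  assumes t: "0 < t" and A [measurable]: "A \<in> sets borel"
  shows "(\<lambda>(x, y). occ_moment t A k x y) \<in> borel_measurable (borel \<Otimes>\<^sub>M borel)"
proof (cases "k = 0")
  case True
  \<comment> \<open>With no sampling time there is nothing to sort. The zeroth moment is needed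
    later as the integral of the constant 1.\<close>
  have "occ_moment t A k x y = ennreal (p t (x - y))" for x y
  proof -
    interpret prob_space "B t x y" using t by (rule prob_space_B)
    show ?thesis by (simp add: occ_moment_def True emeasure_space_1)
  qed
  then show ?thesis by simp
next
  case False
  then have k: "1 \<le> k" by simp
  interpret T: finite_measure "time_measure t" by (rule finite_measure_time_measure)
  interpret product_sigma_finite "\<lambda>_::nat. time_measure t" by standard
  let ?S = "PiM {..<k} (\<lambda>_. time_measure t)"
  interpret S: sigma_finite_measure ?S
    by (rule sigma_finite) auto
  let ?N = "(borel \<Otimes>\<^sub>M borel) \<Otimes>\<^sub>M ?S :: (('a \<times> 'a) \<times> (nat \<Rightarrow> real)) measure"
  let ?I = "Sigma {1..k} (\<lambda>m. {..<m} \<rightarrow>\<^sub>E {..<k})"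
  let ?C = "\<lambda>s m \<pi>. (\<forall>j\<in>{..<m - 1}. s (\<pi> j) < s (\<pi> (Suc j))) \<and> (\<forall>i\<in>{..<k}. \<exists>j\<in>{..<m}. s i = (s (\<pi> j) :: real))"
  let ?F = "\<lambda>w. SUP (m, \<pi>) \<in> ?I. if ?C (snd w) m \<pi> then fdd_int t A m (fst (fst w)) (snd (fst w)) (\<lambda>j. snd w (\<pi> j)) else 0"
  have comp: "(\<lambda>w. snd w i) \<in> borel_measurable ?N" if "i < k" for i
  proof -
    have "(\<lambda>s. s i) \<in> ?S \<rightarrow>\<^sub>M time_measure t"
      using that by (intro measurable_component_singleton) auto
    then have "(\<lambda>s. s i) \<in> borel_measurable ?S"
      by (rule measurable_compose[OF _ measurable_time_measure])
    then show ?thesis by (rule measurable_compose[OF measurable_snd])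
  qed
  have F_meas: "?F \<in> borel_measurable ?N"
  proof (rule borel_measurable_SUP)
    show "countable ?I" by (intro countable_finite finite_SigmaI finite_PiE) auto
    fix i assume "i \<in> ?I"
    then obtain m \<pi> where i: "i = (m, \<pi>)" "1 \<le> m" "\<And>j. j < m \<Longrightarrow> \<pi> j < k"
      by (cases i) auto
    have less: "Measurable.pred ?N (\<lambda>w. snd w a < snd w b)" if "a < k" "b < k" for a b
      using comp[OF that(1)] comp[OF that(2)] by measurable
    have eq: "Measurable.pred ?N (\<lambda>w. snd w a = snd w b)" if "a < k" "b < k" for a b
      using comp[OF that(1)] comp[OF that(2)] by measurable
    have C: "Measurable.pred ?N (\<lambda>w. ?C (snd w) m \<pi>)"
    proof (intro pred_intros_logic pred_intros_finite finite_lessThan)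
      fix j assume "j \<in> {..<m - 1}"
      then have "j < m" "Suc j < m" by auto
      then show "Measurable.pred ?N (\<lambda>w. snd w (\<pi> j) < snd w (\<pi> (Suc j)))"
        by (intro less i)
    next
      fix a j assume "a \<in> {..<k}" "j \<in> {..<m}"
      then show "Measurable.pred ?N (\<lambda>w. snd w a = snd w (\<pi> j))"
        by (intro eq i) auto
    qed
    have G: "(\<lambda>w. fdd_int t A m (fst (fst w)) (snd (fst w)) (\<lambda>j. snd w (\<pi> j))) \<in> borel_measurable ?N"
      using i comp by (intro measurable_fdd_int) auto
    show "(\<lambda>w. case i of (m, \<pi>) \<Rightarrow> if ?C (snd w) m \<pi> then fdd_int t A m (fst (fst w)) (snd (fst w)) (\<lambda>j. snd w (\<pi> j)) else 0)
       \<in> borel_measurable ?N"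
      unfolding i prod.case by (rule measurable_If[OF G _ C[unfolded pred_def]]) simp
  qed
  from F_meas have "(\<lambda>v. \<integral>\<^sup>+s. ?F (v, s) \<partial>?S) \<in> borel_measurable (borel \<Otimes>\<^sub>M borel)"
    by (intro S.borel_measurable_nn_integral) (simp add: case_prod_beta')
  moreover have "occ_moment t A k x y = (\<integral>\<^sup>+s. ?F ((x, y), s) \<partial>?S)" for x y
  proof -
    have pos: "0 < p t (x - y)" using t by (rule p_pos)
    have meas: "(\<lambda>s. ?F ((x, y), s)) \<in> borel_measurable ?S"
      using measurable_Pair2[OF F_meas, of "(x, y)"] by (simp add: space_pair_measure)
    \<comment> \<open>Solving for the probability exhibits it as a measurable function of the times,
      which allows the factor \<open>p t (x - y)\<close> to be moved across the time
      integral.\<close>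
    have "emeasure (B t x y) {\<omega> \<in> space (B t x y). \<forall>i<k. X t x y \<omega> (s i) \<in> A} = ?F ((x, y), s) / ennreal (p t (x - y))"
      if "s \<in> space ?S" for s
    proof -
      have "s i \<in> {0<..<t}" if "i < k" for i
        using \<open>s \<in> space ?S\<close> that by (auto simp: space_PiM PiE_iff)
      then have "?F ((x, y), s) = emeasure (B t x y) {\<omega> \<in> space (B t x y). \<forall>i<k. X t x y \<omega> (s i) \<in> A} * ennreal (p t (x - y))"
        unfolding fst_conv snd_conv using prob_eq_SUP[of t k A s x y] t k A by (simp add: mult.commute)
      then show ?thesis using pos by (simp add: mult_divide_eq_ennreal)
    qed
    then have "occ_moment t A k x y = ennreal (p t (x - y)) * (\<integral>\<^sup>+s. ?F ((x, y), s) / ennreal (p t (x - y)) \<partial>?S)"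
      unfolding occ_moment_def nn_integral_occ_power[OF t A] by (simp cong: nn_integral_cong)
    also have "\<dots> = (\<integral>\<^sup>+s. ?F ((x, y), s) \<partial>?S)"
      unfolding nn_integral_divide[OF meas]
      using pos by (subst ennreal_times_divide, subst mult.commute) (rule mult_divide_eq_ennreal; simp)
    finally show ?thesis .
  qed
  ultimately show ?thesis by (simp add: case_prod_beta')
qed

end

section \<open>Explicit first and second moments for fixed endpoints\<close>

lemma (in sigma_finite_measure) nn_integral_PiM_lessThan_1:
  assumes [measurable]: "F \<in> borel_measurable M"
  shows "(\<integral>\<^sup>+w. F (w 0) \<partial>PiM {..<1::nat} (\<lambda>_. M)) = (\<integral>\<^sup>+u. F u \<partial>M)"
proof -
  interpret product_sigma_finite "\<lambda>_::nat. M" by standard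
  show ?thesis
    using product_nn_integral_singleton[of F 0] by (simp add: lessThan_Suc)
qed

lemma (in sigma_finite_measure) nn_integral_PiM_lessThan_2:
  assumes F [measurable]: "(\<lambda>(u, v). F u v) \<in> borel_measurable (M \<Otimes>\<^sub>M M)"
  shows "(\<integral>\<^sup>+w. F (w 0) (w 1) \<partial>PiM {..<2::nat} (\<lambda>_. M)) = (\<integral>\<^sup>+u. \<integral>\<^sup>+v. F u v \<partial>M \<partial>M)"
proof -
  interpret product_sigma_finite "\<lambda>_::nat. M" by standard
  have [measurable]: "(\<lambda>w. w (0::nat)) \<in> PiM {0, 1} (\<lambda>_. M) \<rightarrow>\<^sub>M M" "(\<lambda>w. w (1::nat)) \<in> PiM {0, 1} (\<lambda>_. M) \<rightarrow>\<^sub>M M"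
    by (auto intro: measurable_component_singleton)
  have "(\<integral>\<^sup>+w. F (w 0) (w 1) \<partial>PiM {..<2::nat} (\<lambda>_. M)) = (\<integral>\<^sup>+w. F (w 0) (w 1) \<partial>PiM (insert 1 {0::nat}) (\<lambda>_. M))"
    by (simp add: lessThan_Suc numeral_2_eq_2)
  also have "\<dots> = (\<integral>\<^sup>+w. \<integral>\<^sup>+v. F ((w(1 := v)) 0) ((w(1 := v)) 1) \<partial>M \<partial>PiM {0::nat} (\<lambda>_. M))"
    by (rule product_nn_integral_insert) (auto simp: insert_commute)
  also have "\<dots> = (\<integral>\<^sup>+w. (\<lambda>u. \<integral>\<^sup>+v. F u v \<partial>M) (w 0) \<partial>PiM {0::nat} (\<lambda>_. M))"
    by simp
  also have "\<dots> = (\<integral>\<^sup>+u. \<integral>\<^sup>+v. F u v \<partial>M \<partial>M)"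
    by (rule product_nn_integral_singleton) measurable
  finally show ?thesis .
qed

context stable_bridge_family
begin

lemma fdd_int_1:
  assumes [measurable]: "A \<in> sets borel" and "0 < s 0" "s 0 < t"
  shows "fdd_int t A 1 x y s = (\<integral>\<^sup>+z. indicator A z * (ennreal (p (s 0) (x - z)) * ennreal (p (t - s 0) (z - y))) \<partial>lborel)"
proof -
  have "fdd_int t A 1 x y s = (\<integral>\<^sup>+w. (\<lambda>z. indicator A z * (ennreal (p (s 0) (x - z)) * ennreal (p (t - s 0) (z - y)))) (w 0) \<partial>PiM {..<1::nat} (\<lambda>_. lborel))"
    using assms by (simp add: fdd_int_def fdd_def ennreal_mult p_nonneg lessThan_Suc)
  also have "\<dots> = (\<integral>\<^sup>+z. indicator A z * (ennreal (p (s 0) (x - z)) * ennreal (p (t - s 0) (z - y))) \<partial>lborel)"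
    by (rule lborel.nn_integral_PiM_lessThan_1) measurable
  finally show ?thesis .
qed

lemma fdd_int_2:
  assumes [measurable]: "A \<in> sets borel" and "0 < s 0" "s 0 < s 1" "s 1 < t"
  shows "fdd_int t A 2 x y s = (\<integral>\<^sup>+z. \<integral>\<^sup>+z'. indicator A z * indicator A z' * ennreal (p (s 1 - s 0) (z - z'))
     * (ennreal (p (s 0) (x - z)) * ennreal (p (t - s 1) (z' - y))) \<partial>lborel \<partial>lborel)"
proof -
  have "fdd_int t A 2 x y s = (\<integral>\<^sup>+w. (\<lambda>z z'. indicator A z * indicator A z' * ennreal (p (s 1 - s 0) (z - z'))
     * (ennreal (p (s 0) (x - z)) * ennreal (p (t - s 1) (z' - y)))) (w 0) (w 1) \<partial>PiM {..<2::nat} (\<lambda>_. lborel))"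
    using assms by (simp add: fdd_int_def fdd_def ennreal_mult p_nonneg lessThan_Suc numeral_2_eq_2 mult_ac)
  also have "\<dots> = (\<integral>\<^sup>+z. \<integral>\<^sup>+z'. indicator A z * indicator A z' * ennreal (p (s 1 - s 0) (z - z'))
     * (ennreal (p (s 0) (x - z)) * ennreal (p (t - s 1) (z' - y))) \<partial>lborel \<partial>lborel)"
    by (rule lborel.nn_integral_PiM_lessThan_2) measurable
  finally show ?thesis .
qed

lemma prob_1:
  assumes "A \<in> sets borel" "0 < u" "u < t"
  shows "ennreal (p t (x - y)) * emeasure (B t x y) {\<omega> \<in> space (B t x y). X t x y \<omega> u \<in> A}
    = (\<integral>\<^sup>+z. indicator A z * (ennreal (p u (x - z)) * ennreal (p (t - u) (z - y))) \<partial>lborel)"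
  using bridge_prob[of t 1 "\<lambda>_. u" A x y] fdd_int_1[of A "\<lambda>_. u" t x y] assms
  by (simp add: fdd_int_def)

lemma prob_2:
  assumes "A \<in> sets borel" "0 < u" "u < v" "v < t"
  shows "ennreal (p t (x - y)) * emeasure (B t x y) {\<omega> \<in> space (B t x y). X t x y \<omega> u \<in> A \<and> X t x y \<omega> v \<in> A}
    = (\<integral>\<^sup>+z. \<integral>\<^sup>+z'. indicator A z * indicator A z' * ennreal (p (v - u) (z - z'))
     * (ennreal (p u (x - z)) * ennreal (p (t - v) (z' - y))) \<partial>lborel \<partial>lborel)"
proof -
  have *: "(\<forall>j<2. P j) \<longleftrightarrow> P 0 \<and> P 1" for P :: "nat \<Rightarrow> bool"
    by (auto simp: less_2_cases_iff)
  show ?thesis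
    using bridge_prob[of t 2 "\<lambda>j. if j = 0 then u else v" A x y] fdd_int_2[of A "\<lambda>j. if j = 0 then u else v" t x y] assms
    by (simp add: fdd_int_def *)
qed

text \<open>The result is left as one integral over pairs (time, position), with x and y confined to
  the two transition factors, the shape required by \<open>nn_integral_endpoints\<close>.\<close>

lemma occ_moment_1:
  assumes t: "0 < t" and A [measurable]: "A \<in> sets borel"
  shows "occ_moment t A 1 x y = (\<integral>\<^sup>+(u, z). indicator A z * (ennreal (p u (x - z)) * ennreal (p (t - u) (z - y))) \<partial>(time_measure t \<Otimes>\<^sub>M lborel))"
proof -
  interpret T: finite_measure "time_measure t" by (rule finite_measure_time_measure)
  interpret B: prob_space "B t x y" using t by (rule prob_space_B)
  interpret P: pair_sigma_finite "B t x y" "time_measure t" ..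
  note [measurable] = measurable_X_time_measure[OF t]
  have "(\<integral>\<^sup>+\<omega>. occ t x y A \<omega> ^ 1 \<partial>B t x y) = (\<integral>\<^sup>+u. \<integral>\<^sup>+\<omega>. indicator A (X t x y \<omega> u) \<partial>B t x y \<partial>time_measure t)"
    unfolding power_one_right occ_def by (rule P.Fubini'[symmetric]) measurable
  then have "occ_moment t A 1 x y = ennreal (p t (x - y)) * (\<integral>\<^sup>+u. \<integral>\<^sup>+\<omega>. indicator A (X t x y \<omega> u) \<partial>B t x y \<partial>time_measure t)"
    by (simp add: occ_moment_def)
  also have "\<dots> = (\<integral>\<^sup>+u. ennreal (p t (x - y)) * (\<integral>\<^sup>+\<omega>. indicator A (X t x y \<omega> u) \<partial>B t x y) \<partial>time_measure t)"
    by (rule nn_integral_cmult[symmetric]) measurable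
  also have "\<dots> = (\<integral>\<^sup>+u. \<integral>\<^sup>+z. indicator A z * (ennreal (p u (x - z)) * ennreal (p (t - u) (z - y))) \<partial>lborel \<partial>time_measure t)"
  proof (rule nn_integral_cong)
    fix u assume "u \<in> space (time_measure t)"
    then have u: "0 < u" "u < t" by auto
    have [measurable]: "(\<lambda>\<omega>. X t x y \<omega> u) \<in> borel_measurable (B t x y)"
      using u by (intro measurable_X_at) auto
    have "(\<integral>\<^sup>+\<omega>. indicator A (X t x y \<omega> u) \<partial>B t x y) = (\<integral>\<^sup>+\<omega>. indicator {\<omega> \<in> space (B t x y). X t x y \<omega> u \<in> A} \<omega> \<partial>B t x y)"
      by (intro nn_integral_cong) (auto simp: indicator_def)
    also have "\<dots> = emeasure (B t x y) {\<omega> \<in> space (B t x y). X t x y \<omega> u \<in> A}"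
      by (rule nn_integral_indicator) measurable
    finally show "ennreal (p t (x - y)) * (\<integral>\<^sup>+\<omega>. indicator A (X t x y \<omega> u) \<partial>B t x y)
       = (\<integral>\<^sup>+z. indicator A z * (ennreal (p u (x - z)) * ennreal (p (t - u) (z - y))) \<partial>lborel)"
      using prob_1[OF A u, of x y] by simp
  qed
  also have "\<dots> = (\<integral>\<^sup>+(u, z). indicator A z * (ennreal (p u (x - z)) * ennreal (p (t - u) (z - y))) \<partial>(time_measure t \<Otimes>\<^sub>M lborel))"
    by (subst lborel.nn_integral_fst[symmetric]) (auto simp: case_prod_beta')
  finally show ?thesis .
qed

text \<open>The diagonal of the product is null, and exchanging the variables carries the triangle
  below it onto the one above, so the square is twice the part with u < v.\<close>

lemma (in -) nn_integral_square_symmetric: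
  fixes f :: "real \<Rightarrow> ennreal"
  assumes [measurable]: "(\<lambda>s. s) \<in> borel_measurable M" "f \<in> borel_measurable M" and "sigma_finite_measure M"
    and diag: "\<And>u. u \<in> space M \<Longrightarrow> AE v in M. v \<noteq> u"
  shows "(\<integral>\<^sup>+u. f u \<partial>M)\<^sup>2 = 2 * (\<integral>\<^sup>+u. \<integral>\<^sup>+v. indicator {u<..} v * (f u * f v) \<partial>M \<partial>M)"
proof -
  interpret M: sigma_finite_measure M by fact
  interpret P: pair_sigma_finite M M ..
  have [measurable]: "(\<lambda>w. indicator {fst w<..} (snd w) :: ennreal) \<in> borel_measurable (M \<Otimes>\<^sub>M M)"
      "(\<lambda>w. indicator {snd w<..} (fst w) :: ennreal) \<in> borel_measurable (M \<Otimes>\<^sub>M M)"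
    unfolding indicator_def greaterThan_iff by measurable
  have [measurable]: "(\<lambda>v. indicator {u<..} v :: ennreal) \<in> borel_measurable M" "(\<lambda>v. indicator {v<..} u :: ennreal) \<in> borel_measurable M" for u
    unfolding indicator_def greaterThan_iff by measurable
  have "(\<integral>\<^sup>+u. f u \<partial>M)\<^sup>2 = (\<integral>\<^sup>+u. \<integral>\<^sup>+v. f u * f v \<partial>M \<partial>M)"
    by (simp add: power2_eq_square nn_integral_cmult nn_integral_multc)
  also have "\<dots> = (\<integral>\<^sup>+u. (\<integral>\<^sup>+v. indicator {u<..} v * (f u * f v) \<partial>M) + (\<integral>\<^sup>+v. indicator {v<..} u * (f v * f u) \<partial>M) \<partial>M)"
  proof (rule nn_integral_cong)
    fix u assume "u \<in> space M"
    have "(\<integral>\<^sup>+v. f u * f v \<partial>M) = (\<integral>\<^sup>+v. indicator {u<..} v * (f u * f v) + indicator {v<..} u * (f v * f u) \<partial>M)"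
      using diag[OF \<open>u \<in> space M\<close>] by (intro nn_integral_cong_AE) (auto elim!: eventually_mono simp: indicator_def mult.commute)
    also have "\<dots> = (\<integral>\<^sup>+v. indicator {u<..} v * (f u * f v) \<partial>M) + (\<integral>\<^sup>+v. indicator {v<..} u * (f v * f u) \<partial>M)"
      by (intro nn_integral_add) measurable
    finally show "(\<integral>\<^sup>+v. f u * f v \<partial>M) = (\<integral>\<^sup>+v. indicator {u<..} v * (f u * f v) \<partial>M) + (\<integral>\<^sup>+v. indicator {v<..} u * (f v * f u) \<partial>M)" .
  qed
  also have "\<dots> = (\<integral>\<^sup>+u. \<integral>\<^sup>+v. indicator {u<..} v * (f u * f v) \<partial>M \<partial>M) + (\<integral>\<^sup>+u. \<integral>\<^sup>+v. indicator {v<..} u * (f v * f u) \<partial>M \<partial>M)"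
    by (intro nn_integral_add) (measurable; simp add: case_prod_beta')+
  also have "(\<integral>\<^sup>+u. \<integral>\<^sup>+v. indicator {v<..} u * (f v * f u) \<partial>M \<partial>M) = (\<integral>\<^sup>+v. \<integral>\<^sup>+u. indicator {v<..} u * (f v * f u) \<partial>M \<partial>M)"
    by (rule P.Fubini') (simp add: case_prod_beta')
  finally show ?thesis by (simp add: mult_2)
qed

lemma AE_time_measure_neq: "AE v in time_measure t. v \<noteq> u"
  unfolding time_measure_def by (subst AE_restrict_space_iff) (auto intro: eventually_mono[OF AE_lborel_singleton[of u]])

text \<open>Writing the squared occupation time as twice an integral over u < v leaves only ordered
  pairs, for which the two-point density applies directly. Off that triangle both integrands vanish
  through the indicator.\<close>

lemma occ_moment_2:
  assumes t: "0 < t" and A [measurable]: "A \<in> sets borel"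
  shows "occ_moment t A 2 x y = 2 * (\<integral>\<^sup>+((u, v), (z, z')). indicator {u<..} v * (indicator A z * indicator A z' * ennreal (p (v - u) (z - z')))
     * (ennreal (p u (x - z)) * ennreal (p (t - v) (z' - y))) \<partial>((time_measure t \<Otimes>\<^sub>M time_measure t) \<Otimes>\<^sub>M (lborel \<Otimes>\<^sub>M lborel)))"
proof -
  interpret T: finite_measure "time_measure t" by (rule finite_measure_time_measure)
  interpret B: prob_space "B t x y" using t by (rule prob_space_B)
  interpret TT: pair_sigma_finite "time_measure t" "time_measure t" ..
  interpret P: pair_sigma_finite "B t x y" "time_measure t \<Otimes>\<^sub>M time_measure t" ..
  interpret LL: sigma_finite_measure "lborel \<Otimes>\<^sub>M lborel :: ('a \<times> 'a) measure" ..
  note X_meas = measurable_X_time_measure[OF t]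
  have [measurable]: "(\<lambda>w. X t x y (fst w) (fst (snd w))) \<in> borel_measurable (B t x y \<Otimes>\<^sub>M (time_measure t \<Otimes>\<^sub>M time_measure t))"
    using measurable_compose[of "\<lambda>w. (fst w, fst (snd w))" "B t x y \<Otimes>\<^sub>M (time_measure t \<Otimes>\<^sub>M time_measure t)", OF _ X_meas] by simp
  have [measurable]: "(\<lambda>w. X t x y (fst w) (snd (snd w))) \<in> borel_measurable (B t x y \<Otimes>\<^sub>M (time_measure t \<Otimes>\<^sub>M time_measure t))"
    using measurable_compose[of "\<lambda>w. (fst w, snd (snd w))" "B t x y \<Otimes>\<^sub>M (time_measure t \<Otimes>\<^sub>M time_measure t)", OF _ X_meas] by simp
  have ind [measurable]: "(\<lambda>w. indicator {f w<..} (g w) :: ennreal) \<in> borel_measurable N"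
    if [measurable]: "f \<in> borel_measurable N" "g \<in> borel_measurable N" for f g :: "_ \<Rightarrow> real" and N
    unfolding indicator_def greaterThan_iff by measurable
  let ?G = "\<lambda>\<omega> w. indicator {fst w<..} (snd w) * (indicator A (X t x y \<omega> (fst w)) * indicator A (X t x y \<omega> (snd w))) :: ennreal"
  have G_meas [measurable]: "(\<lambda>v. ?G (fst v) (snd v)) \<in> borel_measurable (B t x y \<Otimes>\<^sub>M (time_measure t \<Otimes>\<^sub>M time_measure t))"
    by measurable
  have [measurable]: "(\<lambda>v. ?G (snd v) (fst v)) \<in> borel_measurable ((time_measure t \<Otimes>\<^sub>M time_measure t) \<Otimes>\<^sub>M B t x y)"
    using measurable_compose[OF measurable_Pair[OF measurable_snd measurable_fst] G_meas] by simp
  let ?F = "\<lambda>w z. indicator {fst w<..} (snd w) * (indicator A (fst z) * indicator A (snd z) * ennreal (p (snd w - fst w) (fst z - snd z)))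
     * (ennreal (p (fst w) (x - fst z)) * ennreal (p (t - snd w) (snd z - y)))"
  have F_meas [measurable]: "(\<lambda>v. ?F (fst v) (snd v)) \<in> borel_measurable ((time_measure t \<Otimes>\<^sub>M time_measure t) \<Otimes>\<^sub>M (lborel \<Otimes>\<^sub>M lborel))"
    by measurable
  have "occ t x y A \<omega> ^ 2 = 2 * (\<integral>\<^sup>+w. ?G \<omega> w \<partial>(time_measure t \<Otimes>\<^sub>M time_measure t))" if \<omega>: "\<omega> \<in> space (B t x y)" for \<omega>
  proof -
    have [measurable]: "(\<lambda>s. X t x y \<omega> s) \<in> borel_measurable (time_measure t)"
      using measurable_Pair2[OF X_meas \<omega>] by simp
    have "occ t x y A \<omega> ^ 2 = 2 * (\<integral>\<^sup>+u. \<integral>\<^sup>+v. ?G \<omega> (u, v) \<partial>time_measure t \<partial>time_measure t)"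
      unfolding occ_def by (subst nn_integral_square_symmetric) (auto intro: AE_time_measure_neq T.sigma_finite_measure_axioms)
    also have "(\<integral>\<^sup>+u. \<integral>\<^sup>+v. ?G \<omega> (u, v) \<partial>time_measure t \<partial>time_measure t) = (\<integral>\<^sup>+w. ?G \<omega> w \<partial>(time_measure t \<Otimes>\<^sub>M time_measure t))"
      by (rule T.nn_integral_fst) measurable
    finally show ?thesis .
  qed
  then have "(\<integral>\<^sup>+\<omega>. occ t x y A \<omega> ^ 2 \<partial>B t x y) = (\<integral>\<^sup>+\<omega>. 2 * (\<integral>\<^sup>+w. ?G \<omega> w \<partial>(time_measure t \<Otimes>\<^sub>M time_measure t)) \<partial>B t x y)"
    by (intro nn_integral_cong) auto
  also have "\<dots> = 2 * (\<integral>\<^sup>+\<omega>. \<integral>\<^sup>+w. ?G \<omega> w \<partial>(time_measure t \<Otimes>\<^sub>M time_measure t) \<partial>B t x y)"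
    by (rule nn_integral_cmult) measurable
  also have "(\<integral>\<^sup>+\<omega>. \<integral>\<^sup>+w. ?G \<omega> w \<partial>(time_measure t \<Otimes>\<^sub>M time_measure t) \<partial>B t x y) = (\<integral>\<^sup>+w. \<integral>\<^sup>+\<omega>. ?G \<omega> w \<partial>B t x y \<partial>(time_measure t \<Otimes>\<^sub>M time_measure t))"
    by (rule P.Fubini'[symmetric]) (simp add: case_prod_beta')
  finally have "occ_moment t A 2 x y = ennreal (p t (x - y)) * (2 * (\<integral>\<^sup>+w. \<integral>\<^sup>+\<omega>. ?G \<omega> w \<partial>B t x y \<partial>(time_measure t \<Otimes>\<^sub>M time_measure t)))"
    by (simp add: occ_moment_def)
  also have "\<dots> = 2 * (ennreal (p t (x - y)) * (\<integral>\<^sup>+w. \<integral>\<^sup>+\<omega>. ?G \<omega> w \<partial>B t x y \<partial>(time_measure t \<Otimes>\<^sub>M time_measure t)))"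
    by (simp add: mult_ac)
  also have "ennreal (p t (x - y)) * (\<integral>\<^sup>+w. \<integral>\<^sup>+\<omega>. ?G \<omega> w \<partial>B t x y \<partial>(time_measure t \<Otimes>\<^sub>M time_measure t))
      = (\<integral>\<^sup>+w. ennreal (p t (x - y)) * (\<integral>\<^sup>+\<omega>. ?G \<omega> w \<partial>B t x y) \<partial>(time_measure t \<Otimes>\<^sub>M time_measure t))"
    by (rule nn_integral_cmult[symmetric], rule B.borel_measurable_nn_integral) (simp add: case_prod_beta')
  also have "\<dots> = (\<integral>\<^sup>+w. \<integral>\<^sup>+z. ?F w z \<partial>(lborel \<Otimes>\<^sub>M lborel) \<partial>(time_measure t \<Otimes>\<^sub>M time_measure t))"
  proof (rule nn_integral_cong)
    fix w assume "w \<in> space (time_measure t \<Otimes>\<^sub>M time_measure t)"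
    then obtain u v where w: "w = (u, v)" "0 < u" "u < t" "0 < v" "v < t"
      by (cases w) (auto simp: space_pair_measure)
    show "ennreal (p t (x - y)) * (\<integral>\<^sup>+\<omega>. ?G \<omega> w \<partial>B t x y) = (\<integral>\<^sup>+z. ?F w z \<partial>(lborel \<Otimes>\<^sub>M lborel))"
    proof (cases "u < v")
      case False
      then show ?thesis by (simp add: w)
    next
      case True
      have [measurable]: "(\<lambda>\<omega>. X t x y \<omega> u) \<in> borel_measurable (B t x y)" "(\<lambda>\<omega>. X t x y \<omega> v) \<in> borel_measurable (B t x y)"
        using w by (auto intro: measurable_X_at)
      have "(\<integral>\<^sup>+\<omega>. ?G \<omega> w \<partial>B t x y) = (\<integral>\<^sup>+\<omega>. indicator {\<omega> \<in> space (B t x y). X t x y \<omega> u \<in> A \<and> X t x y \<omega> v \<in> A} \<omega> \<partial>B t x y)"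
        using True by (intro nn_integral_cong) (auto simp: indicator_def w)
      also have "\<dots> = emeasure (B t x y) {\<omega> \<in> space (B t x y). X t x y \<omega> u \<in> A \<and> X t x y \<omega> v \<in> A}"
        by (rule nn_integral_indicator) measurable
      finally have "ennreal (p t (x - y)) * (\<integral>\<^sup>+\<omega>. ?G \<omega> w \<partial>B t x y) = (\<integral>\<^sup>+z. \<integral>\<^sup>+z'. ?F w (z, z') \<partial>lborel \<partial>lborel)"
        using prob_2[OF A w(2) True w(5), of x y] True by (simp add: w)
      also have "\<dots> = (\<integral>\<^sup>+z. ?F w z \<partial>(lborel \<Otimes>\<^sub>M lborel))"
        by (rule lborel.nn_integral_fst) measurable
      finally show ?thesis .
    qed
  qed
  also have "\<dots> = (\<integral>\<^sup>+v. ?F (fst v) (snd v) \<partial>((time_measure t \<Otimes>\<^sub>M time_measure t) \<Otimes>\<^sub>M (lborel \<Otimes>\<^sub>M lborel)))"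
    using lborel_pair.nn_integral_fst[OF F_meas] by simp
  finally show ?thesis by (simp add: case_prod_beta')
qed

section \<open>Integrating out the endpoints\<close>

lemma nn_integral_p_left: "0 < t \<Longrightarrow> (\<integral>\<^sup>+x. ennreal (p t (x - z)) \<partial>lborel) = 1"
  using nn_integral_p[of t] nn_integral_distr[of "(+) (- z)" lborel borel "\<lambda>x. ennreal (p t x)"]
  unfolding lborel_distr_plus[of "- z"] by simp

lemma nn_integral_p_right: "0 < t \<Longrightarrow> (\<integral>\<^sup>+y. ennreal (p t (z - y)) \<partial>lborel) = 1"
  using nn_integral_p_left[of t z] stable_density_minus[of \<alpha> t "_ - z"] by simp

text \<open>Tonelli moves the integrals over y and then x inside; each meets a single transition
  factor, of mass one whatever the interior point. The space \<open>M\<close> is abstract so that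
  one sampling time and two are treated alike.\<close>

lemma nn_integral_endpoints:
  fixes c :: "'c \<Rightarrow> ennreal" and z z' :: "'c \<Rightarrow> 'a"
  assumes "sigma_finite_measure M"
    and [measurable]: "c \<in> borel_measurable M" "a \<in> borel_measurable M" "b \<in> borel_measurable M"
      "z \<in> borel_measurable M" "z' \<in> borel_measurable M"
    and pos: "\<And>w. w \<in> space M \<Longrightarrow> 0 < a w" "\<And>w. w \<in> space M \<Longrightarrow> 0 < b w"
  shows "(\<integral>\<^sup>+x. \<integral>\<^sup>+y. \<integral>\<^sup>+w. c w * (ennreal (p (a w) (x - z w)) * ennreal (p (b w) (z' w - y))) \<partial>M \<partial>lborel \<partial>lborel)
    = (\<integral>\<^sup>+w. c w \<partial>M)"
proof -
  interpret M: sigma_finite_measure M by fact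
  interpret P: pair_sigma_finite M "lborel :: 'a measure" ..
  have "(\<integral>\<^sup>+x. \<integral>\<^sup>+y. \<integral>\<^sup>+w. c w * (ennreal (p (a w) (x - z w)) * ennreal (p (b w) (z' w - y))) \<partial>M \<partial>lborel \<partial>lborel)
     = (\<integral>\<^sup>+x. \<integral>\<^sup>+w. \<integral>\<^sup>+y. c w * (ennreal (p (a w) (x - z w)) * ennreal (p (b w) (z' w - y))) \<partial>lborel \<partial>M \<partial>lborel)"
    by (intro nn_integral_cong P.Fubini') measurable
  also have "\<dots> = (\<integral>\<^sup>+x. \<integral>\<^sup>+w. c w * ennreal (p (a w) (x - z w)) \<partial>M \<partial>lborel)"
  proof (intro nn_integral_cong)
    fix x w assume "w \<in> space M"
    have "(\<integral>\<^sup>+y. c w * (ennreal (p (a w) (x - z w)) * ennreal (p (b w) (z' w - y))) \<partial>lborel)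
      = (\<integral>\<^sup>+y. (c w * ennreal (p (a w) (x - z w))) * ennreal (p (b w) (z' w - y)) \<partial>lborel)"
      by (simp add: mult.assoc)
    also have "\<dots> = (c w * ennreal (p (a w) (x - z w))) * (\<integral>\<^sup>+y. ennreal (p (b w) (z' w - y)) \<partial>lborel)"
      by (rule nn_integral_cmult) measurable
    finally show "(\<integral>\<^sup>+y. c w * (ennreal (p (a w) (x - z w)) * ennreal (p (b w) (z' w - y))) \<partial>lborel) = c w * ennreal (p (a w) (x - z w))"
      using pos(2)[OF \<open>w \<in> space M\<close>] by (simp add: nn_integral_p_right)
  qed
  also have "\<dots> = (\<integral>\<^sup>+w. \<integral>\<^sup>+x. c w * ennreal (p (a w) (x - z w)) \<partial>lborel \<partial>M)"
    by (rule P.Fubini') measurable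
  also have "\<dots> = (\<integral>\<^sup>+w. c w \<partial>M)"
  proof (intro nn_integral_cong)
    fix w assume "w \<in> space M"
    have "(\<integral>\<^sup>+x. c w * ennreal (p (a w) (x - z w)) \<partial>lborel) = c w * (\<integral>\<^sup>+x. ennreal (p (a w) (x - z w)) \<partial>lborel)"
      by (rule nn_integral_cmult) measurable
    then show "(\<integral>\<^sup>+x. c w * ennreal (p (a w) (x - z w)) \<partial>lborel) = c w"
      using pos(1)[OF \<open>w \<in> space M\<close>] by (simp add: nn_integral_p_left)
  qed
  finally show ?thesis .
qed

section \<open>The functional behind \<Psi> and T: additivity, monotonicity and
  measurability\<close>

definition bridge_int :: "real \<Rightarrow> 'a set \<Rightarrow> (real \<Rightarrow> real) \<Rightarrow> 'a \<Rightarrow> 'a \<Rightarrow> ennreal" where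
  "bridge_int t A f x y = ennreal (p t (x - y)) * (\<integral>\<^sup>+\<omega>. ennreal (f (occupation_time A t (X t x y \<omega>))) \<partial>B t x y)"

text \<open>Both \<open>stable_Psi\<close> and \<open>stable_T\<close> are real parts of this
  quantity, for f = 1 - exp(-l) and f = l^k. Additivity needs the joint measurability recorded by
  \<open>total_measurable\<close>, which is not automatic for an arbitrary f since the bridges are
  chosen separately for each pair of endpoints.\<close>

definition total :: "real \<Rightarrow> 'a set \<Rightarrow> (real \<Rightarrow> real) \<Rightarrow> ennreal" where
  "total t A f = (\<integral>\<^sup>+x. \<integral>\<^sup>+y. bridge_int t A f x y \<partial>lborel \<partial>lborel)"

definition total_measurable :: "real \<Rightarrow> 'a set \<Rightarrow> (real \<Rightarrow> real) \<Rightarrow> bool" where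
  "total_measurable t A f \<longleftrightarrow> (\<lambda>(x, y). bridge_int t A f x y) \<in> borel_measurable (borel \<Otimes>\<^sub>M borel)"

lemma stable_Psi_eq: "stable_Psi \<alpha> A B X t = enn2real (total t A (\<lambda>l. 1 - exp (- l)))"
  by (simp add: stable_Psi_def total_def bridge_int_def)

lemma stable_T_eq: "stable_T k \<alpha> A B X t = enn2real (total t A (\<lambda>l. l ^ k))"
  by (simp add: stable_T_def total_def bridge_int_def)

lemma occ_le: "occ t x y A \<omega> \<le> ennreal t"
proof -
  have "occ t x y A \<omega> \<le> (\<integral>\<^sup>+s. 1 \<partial>time_measure t)"
    unfolding occ_def by (intro nn_integral_mono) (simp add: indicator_def)
  also have "\<dots> \<le> ennreal t"
    by (cases "0 \<le> t") (auto simp: time_measure_def emeasure_restrict_space space_restrict_space)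
  finally show ?thesis .
qed

lemma ennreal_occupation_time: "ennreal (occupation_time A t (X t x y \<omega>)) = occ t x y A \<omega>"
  unfolding occupation_time_eq using occ_le[of t x y A \<omega>]
  by (intro ennreal_enn2real) (auto simp: le_less_trans)

lemma occupation_time_bounds:
  assumes "0 \<le> t"
  shows "0 \<le> occupation_time A t (X t x y \<omega>)" "occupation_time A t (X t x y \<omega>) \<le> t"
  using occ_le[of t x y A \<omega>] assms
  by (auto simp: occupation_time_def simp flip: ennreal_occupation_time)

lemma measurable_occupation_time:
  assumes "0 < t" "A \<in> sets borel"
  shows "(\<lambda>\<omega>. occupation_time A t (X t x y \<omega>)) \<in> borel_measurable (B t x y)"
  unfolding occupation_time_eq using measurable_occ[OF assms] by measurable

lemma bridge_int_add:
  assumes t: "0 < t" and A: "A \<in> sets borel" and [measurable]: "f \<in> borel_measurable borel" "g \<in> borel_measurable borel"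
    and nonneg: "\<And>l. 0 \<le> l \<Longrightarrow> l \<le> t \<Longrightarrow> 0 \<le> f l" "\<And>l. 0 \<le> l \<Longrightarrow> l \<le> t \<Longrightarrow> 0 \<le> g l"
  shows "bridge_int t A (\<lambda>l. f l + g l) x y = bridge_int t A f x y + bridge_int t A g x y"
proof -
  note [measurable] = measurable_occupation_time[OF t A]
  show ?thesis
    unfolding bridge_int_def distrib_left[symmetric]
    using t by (subst nn_integral_add[symmetric])
      (auto intro!: nn_integral_cong arg_cong2[where f = "(*)"] simp: ennreal_plus nonneg occupation_time_bounds)
qed

lemma bridge_int_cmult:
  assumes t: "0 < t" and A: "A \<in> sets borel" and [measurable]: "f \<in> borel_measurable borel" and "0 \<le> c"
  shows "bridge_int t A (\<lambda>l. c * f l) x y = ennreal c * bridge_int t A f x y"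
proof -
  note [measurable] = measurable_occupation_time[OF t A]
  show ?thesis
    using \<open>0 \<le> c\<close> by (simp add: bridge_int_def ennreal_mult' nn_integral_cmult mult_ac)
qed

lemma bridge_int_mono:
  assumes "0 < t" "\<And>l. 0 \<le> l \<Longrightarrow> l \<le> t \<Longrightarrow> f l \<le> g l"
  shows "bridge_int t A f x y \<le> bridge_int t A g x y"
  unfolding bridge_int_def using assms
  by (intro mult_left_mono nn_integral_mono ennreal_leI) (auto simp: occupation_time_bounds)

lemma bridge_int_finite:
  assumes "0 < t" "\<And>l. 0 \<le> l \<Longrightarrow> l \<le> t \<Longrightarrow> f l \<le> c"
  shows "bridge_int t A f x y < \<infinity>"
proof -
  interpret prob_space "B t x y" using assms(1) by (rule prob_space_B)
  have "bridge_int t A f x y \<le> bridge_int t A (\<lambda>_. c) x y"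
    using assms by (intro bridge_int_mono)
  also have "\<dots> < \<infinity>"
    by (simp add: bridge_int_def emeasure_space_1 ennreal_mult_less_top)
  finally show ?thesis .
qed

lemma total_mono:
  assumes "0 < t" "\<And>l. 0 \<le> l \<Longrightarrow> l \<le> t \<Longrightarrow> f l \<le> g l"
  shows "total t A f \<le> total t A g"
  unfolding total_def using assms by (intro nn_integral_mono bridge_int_mono)

lemma total_measurable_add:
  assumes "0 < t" "A \<in> sets borel" "f \<in> borel_measurable borel" "g \<in> borel_measurable borel"
    and "\<And>l. 0 \<le> l \<Longrightarrow> l \<le> t \<Longrightarrow> 0 \<le> f l" "\<And>l. 0 \<le> l \<Longrightarrow> l \<le> t \<Longrightarrow> 0 \<le> g l"
    and "total_measurable t A f" "total_measurable t A g"
  shows "total_measurable t A (\<lambda>l. f l + g l)"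
proof -
  have "bridge_int t A (\<lambda>l. f l + g l) x y = bridge_int t A f x y + bridge_int t A g x y" for x y
    using assms(1-6) by (rule bridge_int_add)
  then show ?thesis using assms(7,8) by (simp add: total_measurable_def case_prod_beta')
qed

lemma total_add:
  assumes "0 < t" "A \<in> sets borel" "f \<in> borel_measurable borel" "g \<in> borel_measurable borel"
    and "\<And>l. 0 \<le> l \<Longrightarrow> l \<le> t \<Longrightarrow> 0 \<le> f l" "\<And>l. 0 \<le> l \<Longrightarrow> l \<le> t \<Longrightarrow> 0 \<le> g l"
    and fm: "total_measurable t A f" "total_measurable t A g"
  shows "total t A (\<lambda>l. f l + g l) = total t A f + total t A g"
proof -
  have [measurable]: "(\<lambda>(x, y). bridge_int t A f x y) \<in> borel_measurable (borel \<Otimes>\<^sub>M borel)"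
    "(\<lambda>(x, y). bridge_int t A g x y) \<in> borel_measurable (borel \<Otimes>\<^sub>M borel)"
    using fm by (auto simp: total_measurable_def)
  have "bridge_int t A (\<lambda>l. f l + g l) x y = bridge_int t A f x y + bridge_int t A g x y" for x y
    using assms(1-6) by (rule bridge_int_add)
  then show ?thesis by (simp add: total_def nn_integral_add)
qed

lemma total_measurable_cmult:
  assumes "0 < t" "A \<in> sets borel" "f \<in> borel_measurable borel" "0 \<le> c" "total_measurable t A f"
  shows "total_measurable t A (\<lambda>l. c * f l)"
  using assms(5) unfolding total_measurable_def bridge_int_cmult[OF assms(1-4)] by simp

lemma total_cmult:
  assumes "0 < t" "A \<in> sets borel" "f \<in> borel_measurable borel" "0 \<le> c" and fm: "total_measurable t A f"
  shows "total t A (\<lambda>l. c * f l) = ennreal c * total t A f"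
proof -
  have [measurable]: "(\<lambda>(x, y). bridge_int t A f x y) \<in> borel_measurable (borel \<Otimes>\<^sub>M borel)"
    using fm by (auto simp: total_measurable_def)
  show ?thesis
    unfolding total_def bridge_int_cmult[OF assms(1-4)] by (simp add: nn_integral_cmult)
qed

text \<open>At each pair of endpoints a bounded f has finite \<open>bridge_int\<close>, so g is
  recovered by subtracting f from f + g in \<open>ennreal\<close>. Finiteness is pointwise only: for
  f = exp(-l) the integral over all endpoints is infinite.\<close>

lemma total_measurable_cancel:
  assumes "0 < t" "A \<in> sets borel" "f \<in> borel_measurable borel" "g \<in> borel_measurable borel"
    and "\<And>l. 0 \<le> l \<Longrightarrow> l \<le> t \<Longrightarrow> 0 \<le> f l" "\<And>l. 0 \<le> l \<Longrightarrow> l \<le> t \<Longrightarrow> 0 \<le> g l"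
    and bound: "\<And>l. 0 \<le> l \<Longrightarrow> l \<le> t \<Longrightarrow> f l \<le> c"
    and fm: "total_measurable t A f" "total_measurable t A (\<lambda>l. f l + g l)"
  shows "total_measurable t A g"
proof -
  have "bridge_int t A g x y = bridge_int t A (\<lambda>l. f l + g l) x y - bridge_int t A f x y" for x y
  proof -
    have "bridge_int t A (\<lambda>l. f l + g l) x y = bridge_int t A f x y + bridge_int t A g x y"
      using assms(1-6) by (rule bridge_int_add)
    moreover have "bridge_int t A f x y < \<infinity>"
      using assms(1) bound by (rule bridge_int_finite)
    ultimately show ?thesis by (simp add: ennreal_add_diff_cancel_left)
  qed
  then show ?thesis using fm unfolding total_measurable_def by (simp add: case_prod_beta')
qed

lemma bridge_int_power: "bridge_int t A (\<lambda>l. l ^ k) x y = occ_moment t A k x y"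
proof -
  have "ennreal (occupation_time A t (X t x y \<omega>) ^ k) = occ t x y A \<omega> ^ k" for \<omega>
    unfolding ennreal_occupation_time[symmetric] by (rule ennreal_power[symmetric]) (simp add: occupation_time_def)
  then show ?thesis by (simp add: bridge_int_def occ_moment_def)
qed

lemma total_measurable_power:
  "0 < t \<Longrightarrow> A \<in> sets borel \<Longrightarrow> total_measurable t A (\<lambda>l. l ^ k)"
  unfolding total_measurable_def bridge_int_power by (rule measurable_occ_moment)

lemma occ_Compl:
  assumes t: "0 < t" and A [measurable]: "A \<in> sets borel" and \<omega>: "\<omega> \<in> space (B t x y)"
  shows "occ t x y A \<omega> + occ t x y (- A) \<omega> = ennreal t"
proof -
  have [measurable]: "(\<lambda>s. X t x y \<omega> s) \<in> borel_measurable (time_measure t)"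
    using measurable_Pair2[OF measurable_X_time_measure[OF t] \<omega>] by simp
  have "occ t x y A \<omega> + occ t x y (- A) \<omega> = (\<integral>\<^sup>+s. indicator A (X t x y \<omega> s) + indicator (- A) (X t x y \<omega> s) \<partial>time_measure t)"
    unfolding occ_def by (rule nn_integral_add[symmetric]) measurable
  also have "\<dots> = (\<integral>\<^sup>+s. 1 \<partial>time_measure t)"
    by (intro nn_integral_cong) (auto simp: indicator_def)
  also have "\<dots> = ennreal t"
    using t by (simp add: time_measure_def emeasure_restrict_space space_restrict_space)
  finally show ?thesis .
qed

text \<open>Written through the occupation time \<open>t - l\<close> of the complement, the exponential series has nonnegative terms only.\<close>

lemma total_measurable_exp:
  assumes t: "0 < t" and A [measurable]: "A \<in> sets borel"
  shows "total_measurable t A (\<lambda>l. exp (- l))"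
proof -
  have "bridge_int t A (\<lambda>l. exp (- l)) x y = ennreal (exp (- t)) * (\<Sum>k. occ_moment t (- A) k x y * ennreal (1 / fact k))" for x y
  proof -
    have [measurable]: "occ t x y (- A) \<in> borel_measurable (B t x y)"
      using t by (rule measurable_occ) measurable
    have "(\<integral>\<^sup>+\<omega>. ennreal (exp (- occupation_time A t (X t x y \<omega>))) \<partial>B t x y)
      = (\<integral>\<^sup>+\<omega>. ennreal (exp (- t)) * (\<Sum>k. occ t x y (- A) \<omega> ^ k * ennreal (1 / fact k)) \<partial>B t x y)"
    proof (rule nn_integral_cong)
      fix \<omega> assume \<omega>: "\<omega> \<in> space (B t x y)"
      let ?l = "occupation_time A t (X t x y \<omega>)" and ?l' = "occupation_time (- A) t (X t x y \<omega>)"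
      have "ennreal (?l + ?l') = ennreal t"
        using occ_Compl[OF t A \<omega>] t by (simp add: ennreal_plus occupation_time_bounds ennreal_occupation_time)
      then have l: "?l + ?l' = t" using t by (subst (asm) ennreal_inj) (auto simp: occupation_time_bounds)
      have "(\<lambda>k. ?l' ^ k /\<^sub>R fact k) sums exp ?l'" by (rule exp_converges)
      then have "(\<lambda>k. ennreal (?l' ^ k * (1 / fact k))) sums ennreal (exp ?l')"
        using t by (subst sums_ennreal) (auto simp: occupation_time_bounds divide_inverse mult.commute)
      then have "ennreal (exp ?l') = (\<Sum>k. ennreal (?l' ^ k * (1 / fact k)))"
        by (simp add: sums_iff)
      also have "\<dots> = (\<Sum>k. occ t x y (- A) \<omega> ^ k * ennreal (1 / fact k))"
        using t by (simp only: ennreal_mult' ennreal_power[symmetric] ennreal_occupation_time occupation_time_bounds zero_le_power less_imp_le ennreal_mult'')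
      finally have "ennreal (exp ?l') = (\<Sum>k. occ t x y (- A) \<omega> ^ k * ennreal (1 / fact k))" .
      moreover have "exp (- ?l) = exp (- t) * exp ?l'" using l by (simp flip: exp_add)
      ultimately show "ennreal (exp (- ?l)) = ennreal (exp (- t)) * (\<Sum>k. occ t x y (- A) \<omega> ^ k * ennreal (1 / fact k))"
        by (simp add: ennreal_mult')
    qed
    also have "\<dots> = ennreal (exp (- t)) * (\<Sum>k. (\<integral>\<^sup>+\<omega>. occ t x y (- A) \<omega> ^ k \<partial>B t x y) * ennreal (1 / fact k))"
      by (simp add: nn_integral_cmult nn_integral_suminf nn_integral_multc)
    finally show ?thesis
      by (simp add: bridge_int_def occ_moment_def mult.left_commute mult.assoc flip: ennreal_suminf_cmult)
  qed
  moreover have [measurable]: "(\<lambda>(x, y). occ_moment t (- A) k x y) \<in> borel_measurable (borel \<Otimes>\<^sub>M borel)" for k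
    using t by (rule measurable_occ_moment) measurable
  ultimately show ?thesis by (simp add: total_measurable_def case_prod_beta')
qed

section \<open>First and second moments after integration over the endpoints\<close>

lemma total_1:
  assumes t: "0 < t" and A [measurable]: "A \<in> sets borel"
  shows "total t A (\<lambda>l. l) = ennreal t * emeasure lborel A"
proof -
  interpret T: finite_measure "time_measure t" by (rule finite_measure_time_measure)
  interpret P: pair_sigma_finite "time_measure t" "lborel :: 'a measure" ..
  have "total t A (\<lambda>l. l) = (\<integral>\<^sup>+x. \<integral>\<^sup>+y. occ_moment t A 1 x y \<partial>lborel \<partial>lborel)"
    using bridge_int_power[of t A 1] by (simp add: total_def)
  also have "\<dots> = (\<integral>\<^sup>+w. indicator A (snd w) \<partial>(time_measure t \<Otimes>\<^sub>M lborel))"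
    unfolding occ_moment_1[OF t A] case_prod_beta'
    by (rule nn_integral_endpoints) (auto simp: space_pair_measure intro: P.sigma_finite_measure_axioms)
  also have "\<dots> = (\<integral>\<^sup>+u. \<integral>\<^sup>+z. indicator A z \<partial>lborel \<partial>time_measure t)"
    by (subst lborel.nn_integral_fst[symmetric]) auto
  also have "\<dots> = ennreal t * emeasure lborel A"
    using t by (simp add: time_measure_def emeasure_restrict_space space_restrict_space mult.commute)
  finally show ?thesis .
qed

text \<open>The heat content of a Borel set as a nonnegative integral;
  \<open>heat_content_eq\<close> links it to \<open>heat_content\<close> at positive times.\<close>

definition heat :: "'a set \<Rightarrow> real \<Rightarrow> ennreal" where
  "heat A a = (\<integral>\<^sup>+z. \<integral>\<^sup>+z'. indicator A z * indicator A z' * ennreal (p a (z - z')) \<partial>lborel \<partial>lborel)"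

lemma measurable_heat [measurable]:
  assumes [measurable]: "A \<in> sets borel"
  shows "heat A \<in> borel_measurable borel"
  unfolding heat_def by measurable

lemma total_2:
  assumes t: "0 < t" and A [measurable]: "A \<in> sets borel"
  shows "total t A (\<lambda>l. l\<^sup>2) = 2 * (\<integral>\<^sup>+u. \<integral>\<^sup>+v. indicator {u<..} v * heat A (v - u) \<partial>time_measure t \<partial>time_measure t)"
proof -
  interpret T: finite_measure "time_measure t" by (rule finite_measure_time_measure)
  interpret TT: pair_sigma_finite "time_measure t" "time_measure t" ..
  interpret P: pair_sigma_finite "time_measure t \<Otimes>\<^sub>M time_measure t" "lborel \<Otimes>\<^sub>M lborel :: ('a \<times> 'a) measure" ..
  let ?M = "(time_measure t \<Otimes>\<^sub>M time_measure t) \<Otimes>\<^sub>M (lborel \<Otimes>\<^sub>M lborel :: ('a \<times> 'a) measure)"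
  have ind [measurable]: "(\<lambda>w. indicator {f w<..} (g w) :: ennreal) \<in> borel_measurable N"
    if [measurable]: "f \<in> borel_measurable N" "g \<in> borel_measurable N" for f g :: "_ \<Rightarrow> real" and N
    unfolding indicator_def greaterThan_iff by measurable
  let ?c = "\<lambda>w z. indicator {fst w<..} (snd w) * (indicator A (fst z) * indicator A (snd z) * ennreal (p (snd w - fst w) (fst z - snd z)))"
  let ?F = "\<lambda>x y w. ?c (fst w) (snd w) * (ennreal (p (fst (fst w)) (x - fst (snd w))) * ennreal (p (t - snd (fst w)) (snd (snd w) - y)))"
  have "total t A (\<lambda>l. l\<^sup>2) = (\<integral>\<^sup>+x. \<integral>\<^sup>+y. 2 * (\<integral>\<^sup>+w. ?F x y w \<partial>?M) \<partial>lborel \<partial>lborel)"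
    unfolding total_def bridge_int_power occ_moment_2[OF t A] case_prod_beta' ..
  also have "\<dots> = 2 * (\<integral>\<^sup>+x. \<integral>\<^sup>+y. \<integral>\<^sup>+w. ?F x y w \<partial>?M \<partial>lborel \<partial>lborel)"
  proof -
    have "(\<integral>\<^sup>+x. \<integral>\<^sup>+y. 2 * (\<integral>\<^sup>+w. ?F x y w \<partial>?M) \<partial>lborel \<partial>lborel) = (\<integral>\<^sup>+x. 2 * (\<integral>\<^sup>+y. \<integral>\<^sup>+w. ?F x y w \<partial>?M \<partial>lborel) \<partial>lborel)"
      by (intro nn_integral_cong nn_integral_cmult P.borel_measurable_nn_integral) measurable
    also have "\<dots> = 2 * (\<integral>\<^sup>+x. \<integral>\<^sup>+y. \<integral>\<^sup>+w. ?F x y w \<partial>?M \<partial>lborel \<partial>lborel)"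
      by (intro nn_integral_cmult lborel.borel_measurable_nn_integral P.borel_measurable_nn_integral) measurable
    finally show ?thesis .
  qed
  also have "(\<integral>\<^sup>+x. \<integral>\<^sup>+y. \<integral>\<^sup>+w. ?F x y w \<partial>?M \<partial>lborel \<partial>lborel) = (\<integral>\<^sup>+w. ?c (fst w) (snd w) \<partial>?M)"
    by (rule nn_integral_endpoints) (auto simp: space_pair_measure intro: P.sigma_finite_measure_axioms)
  also have "\<dots> = (\<integral>\<^sup>+w. \<integral>\<^sup>+z. ?c w z \<partial>(lborel \<Otimes>\<^sub>M lborel) \<partial>(time_measure t \<Otimes>\<^sub>M time_measure t))"
    by (subst lborel_pair.nn_integral_fst[symmetric]) auto
  also have "\<dots> = (\<integral>\<^sup>+w. indicator {fst w<..} (snd w) * heat A (snd w - fst w) \<partial>(time_measure t \<Otimes>\<^sub>M time_measure t))"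
  proof (rule nn_integral_cong)
    fix w :: "real \<times> real"
    have "(\<integral>\<^sup>+z. ?c w z \<partial>(lborel \<Otimes>\<^sub>M lborel)) = indicator {fst w<..} (snd w) *
       (\<integral>\<^sup>+z. indicator A (fst z) * indicator A (snd z) * ennreal (p (snd w - fst w) (fst z - snd z)) \<partial>(lborel \<Otimes>\<^sub>M lborel))"
      by (rule nn_integral_cmult) measurable
    also have "(\<integral>\<^sup>+z. indicator A (fst z) * indicator A (snd z) * ennreal (p (snd w - fst w) (fst z - snd z)) \<partial>(lborel \<Otimes>\<^sub>M lborel))
       = heat A (snd w - fst w)"
      unfolding heat_def by (subst lborel.nn_integral_fst[symmetric]) auto
    finally show "(\<integral>\<^sup>+z. ?c w z \<partial>(lborel \<Otimes>\<^sub>M lborel)) = indicator {fst w<..} (snd w) * heat A (snd w - fst w)" .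
  qed
  also have "\<dots> = (\<integral>\<^sup>+u. \<integral>\<^sup>+v. indicator {u<..} v * heat A (v - u) \<partial>time_measure t \<partial>time_measure t)"
    by (subst T.nn_integral_fst[symmetric]) auto
  finally show ?thesis .
qed

end

section \<open>Short-time behaviour of the heat content and of its time average\<close>

text \<open>Fatou bounds the liminf from below only; together with a termwise upper bound this
  already forces convergence, also towards an infinite limit.\<close>

lemma tendsto_if_le_liminf:
  fixes f :: "nat \<Rightarrow> ennreal"
  assumes "\<And>n. f n \<le> L" "L \<le> liminf f"
  shows "f \<longlonglongrightarrow> L"
proof -
  have "limsup f \<le> L" using assms(1) by (intro Limsup_bounded) auto
  moreover have "liminf f \<le> limsup f" by (intro Liminf_le_Limsup) auto
  ultimately show ?thesis
    using assms(2) by (subst tendsto_iff_Liminf_eq_Limsup) auto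
qed

lemma measurable_indicator_greaterThan:
  fixes f g :: "'b \<Rightarrow> real"
  assumes [measurable]: "f \<in> borel_measurable M" "g \<in> borel_measurable M"
  shows "(\<lambda>w. indicator {f w<..} (g w) :: ennreal) \<in> borel_measurable M"
  unfolding indicator_def greaterThan_iff by measurable

context stable_bridge_family
begin

text \<open>Drop the indicator of A, exchange the integrals, and integrate the density over z to 1.
  The set V is A itself in \<open>heat_le\<close> and the excess of an open superset in
  \<open>heat_tendsto\<close>.\<close>

lemma nn_integral_indicator_p_le:
  assumes [measurable]: "A \<in> sets borel" "V \<in> sets borel" and a: "0 < a"
  shows "(\<integral>\<^sup>+z. \<integral>\<^sup>+z'. indicator A z * indicator V z' * ennreal (p a (z - z')) \<partial>lborel \<partial>lborel) \<le> emeasure lborel V"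
proof -
  have "(\<integral>\<^sup>+z. \<integral>\<^sup>+z'. indicator A z * indicator V z' * ennreal (p a (z - z')) \<partial>lborel \<partial>lborel)
     \<le> (\<integral>\<^sup>+z. \<integral>\<^sup>+z'. indicator V z' * ennreal (p a (z - z')) \<partial>lborel \<partial>lborel)"
    by (intro nn_integral_mono) (auto simp: indicator_def)
  also have "\<dots> = (\<integral>\<^sup>+z'. \<integral>\<^sup>+z. indicator V z' * ennreal (p a (z - z')) \<partial>lborel \<partial>lborel)"
    by (rule lborel_pair.Fubini') measurable
  also have "\<dots> = (\<integral>\<^sup>+z'. indicator V z' \<partial>lborel)"
    using a by (simp add: nn_integral_cmult nn_integral_p_left)
  finally show ?thesis by simp
qed

lemma heat_le:
  assumes "A \<in> sets borel" "0 < a"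
  shows "heat A a \<le> emeasure lborel A"
  unfolding heat_def using assms by (intro nn_integral_indicator_p_le)

text \<open>Substitute z' = z - a^(1/\<alpha>) u; the Jacobian cancels the prefactor from
  \<open>stable_density_scale\<close>. The time then sits in the argument of f only, against the
  fixed density \<open>p 1\<close>, so pointwise limits can be taken.\<close>

lemma nn_integral_p_rescale:
  assumes [measurable]: "f \<in> borel_measurable borel" and a: "0 < a"
  shows "(\<integral>\<^sup>+z'. f z' * ennreal (p a (z - z')) \<partial>lborel) = (\<integral>\<^sup>+u. f (z - a powr (1 / \<alpha>) *\<^sub>R u) * ennreal (p 1 u) \<partial>lborel)"
proof -
  define c where "c = a powr (1 / \<alpha>)"
  have c: "0 < c" using a by (simp add: c_def)
  have pc: "\<bar>- c\<bar> ^ DIM('a) * p a (c *\<^sub>R u) = p 1 u" for u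
  proof -
    have "a powr (- 1 / \<alpha>) * c = 1" "\<bar>- c\<bar> ^ DIM('a) * a powr (- DIM('a) / \<alpha>) = 1"
      using a c by (simp_all add: c_def powr_minus powr_powr flip: powr_realpow powr_add)
    then show ?thesis
      by (simp add: stable_density_scale[OF \<alpha>_pos a, of "c *\<^sub>R u"] mult.assoc[symmetric])
  qed
  have "(\<integral>\<^sup>+z'. f z' * ennreal (p a (z - z')) \<partial>lborel)
     = (\<integral>\<^sup>+z'. f z' * ennreal (p a (z - z')) \<partial>density (distr lborel borel (\<lambda>x. z + (- c) *\<^sub>R x)) (\<lambda>_. ennreal (\<bar>- c\<bar> ^ DIM('a))))"
    using lborel_affine[of "- c" z] c by simp
  also have "\<dots> = (\<integral>\<^sup>+u. ennreal (\<bar>- c\<bar> ^ DIM('a)) * (f (z + (- c) *\<^sub>R u) * ennreal (p a (z - (z + (- c) *\<^sub>R u)))) \<partial>lborel)"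
    by (subst nn_integral_density, measurable, subst nn_integral_distr, measurable)
  also have "\<dots> = (\<integral>\<^sup>+u. f (z - c *\<^sub>R u) * ennreal (p 1 u) \<partial>lborel)"
    using a by (intro nn_integral_cong) (simp add: pc[symmetric] ennreal_mult p_nonneg mult_ac)
  finally show ?thesis by (simp add: c_def)
qed

text \<open>Fatou's lemma applies after replacing one copy of \<open>A\<close> by an open superset \<open>U\<close>, for which
  \<open>z \<in> A\<close> implies \<open>z - c n *\<^sub>R u \<in> U\<close> eventually.\<close>

lemma heat_tendsto:
  assumes A [measurable]: "A \<in> sets borel" and a: "\<And>n. 0 < a n" "a \<longlonglongrightarrow> 0"
  shows "(\<lambda>n. heat A (a n)) \<longlonglongrightarrow> emeasure lborel A"
proof (rule tendsto_if_le_liminf)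
  show "heat A (a n) \<le> emeasure lborel A" for n
    using A a(1) by (rule heat_le)
  show "emeasure lborel A \<le> liminf (\<lambda>n. heat A (a n))"
  proof (rule ennreal_le_epsilon)
    fix e :: real assume "0 < e"
    have "A \<in> sets lebesgue" using A by auto
    then obtain U where U: "open U" "A \<subseteq> U" "U - A \<in> lmeasurable" "emeasure lebesgue (U - A) < ennreal e"
      using sets_lebesgue_outer_open \<open>0 < e\<close> by blast
    have [measurable]: "U \<in> sets borel" using U(1) by simp
    have Ve: "emeasure lborel (U - A) \<le> ennreal e" using U(4) by simp
    let ?c = "\<lambda>n. a n powr (1 / \<alpha>)"
    let ?f = "\<lambda>n w. indicator A (fst w) * indicator U (fst w - ?c n *\<^sub>R snd w) * ennreal (p 1 (snd w))"
    have c0: "?c \<longlonglongrightarrow> 0"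
      using a \<alpha>_pos tendsto_powr2[of a 0 sequentially "\<lambda>_. 1 / \<alpha>" "1 / \<alpha>"] by (simp add: less_imp_le)
    have "emeasure lborel A = (\<integral>\<^sup>+z. \<integral>\<^sup>+u. indicator A z * ennreal (p 1 u) \<partial>lborel \<partial>lborel)"
      by (simp add: nn_integral_cmult nn_integral_p)
    also have "\<dots> = (\<integral>\<^sup>+w. indicator A (fst w) * ennreal (p 1 (snd w)) \<partial>(lborel \<Otimes>\<^sub>M lborel))"
      by (subst lborel.nn_integral_fst[symmetric]) auto
    also have "\<dots> \<le> (\<integral>\<^sup>+w. liminf (\<lambda>n. ?f n w) \<partial>(lborel \<Otimes>\<^sub>M lborel))"
    proof (rule nn_integral_mono)
      fix w :: "'a \<times> 'a"
      show "indicator A (fst w) * ennreal (p 1 (snd w)) \<le> liminf (\<lambda>n. ?f n w)"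
      proof (cases "fst w \<in> A")
        case True
        have "(\<lambda>n. fst w - ?c n *\<^sub>R snd w) \<longlonglongrightarrow> fst w - 0 *\<^sub>R snd w"
          by (intro tendsto_intros c0)
        then have "\<forall>\<^sub>F n in sequentially. fst w - ?c n *\<^sub>R snd w \<in> U"
          using U(1,2) True by (intro topological_tendstoD) auto
        then show ?thesis
          by (intro Liminf_bounded) (auto elim!: eventually_mono simp: True)
      qed simp
    qed
    also have "\<dots> \<le> liminf (\<lambda>n. \<integral>\<^sup>+w. ?f n w \<partial>(lborel \<Otimes>\<^sub>M lborel))"
      by (rule nn_integral_liminf) measurable
    also have "\<dots> \<le> liminf (\<lambda>n. ennreal e + heat A (a n))"
    proof (intro Liminf_mono always_eventually allI)
      fix n
      have "(\<integral>\<^sup>+w. ?f n w \<partial>(lborel \<Otimes>\<^sub>M lborel)) = (\<integral>\<^sup>+z. \<integral>\<^sup>+u. ?f n (z, u) \<partial>lborel \<partial>lborel)"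
        by (rule lborel.nn_integral_fst[symmetric]) measurable
      also have "\<dots> = (\<integral>\<^sup>+z. \<integral>\<^sup>+z'. indicator A z * indicator U z' * ennreal (p (a n) (z - z')) \<partial>lborel \<partial>lborel)"
      proof (rule nn_integral_cong)
        fix z :: 'a
        show "(\<integral>\<^sup>+u. ?f n (z, u) \<partial>lborel) = (\<integral>\<^sup>+z'. indicator A z * indicator U z' * ennreal (p (a n) (z - z')) \<partial>lborel)"
          using nn_integral_p_rescale[of "\<lambda>z'. indicator A z * indicator U z'" "a n" z] a(1) by simp
      qed
      \<comment> \<open>Splitting U into U - A and A isolates the error of the replacement, which is
        at most |U - A| \<le> e uniformly in n.\<close>
      also have "\<dots> = (\<integral>\<^sup>+z. (\<integral>\<^sup>+z'. indicator A z * indicator (U - A) z' * ennreal (p (a n) (z - z')) \<partial>lborel)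
          + (\<integral>\<^sup>+z'. indicator A z * indicator A z' * ennreal (p (a n) (z - z')) \<partial>lborel) \<partial>lborel)"
        using U(2) by (subst nn_integral_add[symmetric]) (auto intro!: nn_integral_cong simp: indicator_def)
      also have "\<dots> = (\<integral>\<^sup>+z. \<integral>\<^sup>+z'. indicator A z * indicator (U - A) z' * ennreal (p (a n) (z - z')) \<partial>lborel \<partial>lborel) + heat A (a n)"
        unfolding heat_def by (rule nn_integral_add) measurable
      also have "\<dots> \<le> ennreal e + heat A (a n)"
        using a(1) by (intro add_right_mono order_trans[OF nn_integral_indicator_p_le Ve]) auto
      finally show "(\<integral>\<^sup>+w. ?f n w \<partial>(lborel \<Otimes>\<^sub>M lborel)) \<le> ennreal e + heat A (a n)" .
    qed
    also have "\<dots> = ennreal e + liminf (\<lambda>n. heat A (a n))"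
      by (rule Liminf_const_add) simp
    finally show "emeasure lborel A \<le> liminf (\<lambda>n. heat A (a n)) + ennreal e"
      by (simp add: add.commute)
  qed
qed

text \<open>The double time integral of the theorem with the heat content in place of its deficit.
  It is not normalised: the triangle has area 1/2.\<close>

definition heat_avg :: "'a set \<Rightarrow> real \<Rightarrow> ennreal" where
  "heat_avg A t = (\<integral>\<^sup>+u. \<integral>\<^sup>+v. indicator {u<..} v * heat A (t * (v - u)) \<partial>time_measure 1 \<partial>time_measure 1)"

lemma nn_integral_time_measure_scale:
  assumes [measurable]: "f \<in> borel_measurable borel" and t: "0 < t"
  shows "(\<integral>\<^sup>+s. f s \<partial>time_measure t) = ennreal t * (\<integral>\<^sup>+s. f (t * s) \<partial>time_measure 1)"
proof -
  have "(\<integral>\<^sup>+s. f s \<partial>time_measure t) = (\<integral>\<^sup>+s. f s * indicator {0<..<t} s \<partial>lborel)"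
    by (rule nn_integral_time_measure) measurable
  also have "\<dots> = ennreal \<bar>t\<bar> * (\<integral>\<^sup>+s. f (0 + t * s) * indicator {0<..<t} (0 + t * s) \<partial>lborel)"
    using t by (intro nn_integral_real_affine) auto
  also have "\<dots> = ennreal t * (\<integral>\<^sup>+s. f (t * s) * indicator {0<..<1} s \<partial>lborel)"
    using t by (auto intro!: arg_cong2[where f = "(*)"] nn_integral_cong simp: indicator_def zero_less_mult_iff)
  also have "(\<integral>\<^sup>+s. f (t * s) * indicator {0<..<1} s \<partial>lborel) = (\<integral>\<^sup>+s. f (t * s) \<partial>time_measure 1)"
    by (rule nn_integral_time_measure[symmetric]) measurable
  finally show ?thesis .
qed

lemma total_2_heat_avg:
  assumes t: "0 < t" and A [measurable]: "A \<in> sets borel"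
  shows "total t A (\<lambda>l. l\<^sup>2) = 2 * ennreal (t\<^sup>2) * heat_avg A t"
proof -
  interpret T: finite_measure "time_measure t" by (rule finite_measure_time_measure)
  interpret T1: finite_measure "time_measure 1" by (rule finite_measure_time_measure)
  note [measurable] = measurable_indicator_greaterThan
  have "(\<integral>\<^sup>+u. \<integral>\<^sup>+v. indicator {u<..} v * heat A (v - u) \<partial>time_measure t \<partial>time_measure t)
     = (\<integral>\<^sup>+u. ennreal t * (\<integral>\<^sup>+v. indicator {u<..} (t * v) * heat A (t * v - u) \<partial>time_measure 1) \<partial>time_measure t)"
    using t by (intro nn_integral_cong nn_integral_time_measure_scale) measurable
  also have "\<dots> = ennreal t * (\<integral>\<^sup>+u. ennreal t * (\<integral>\<^sup>+v. indicator {t * u<..} (t * v) * heat A (t * v - t * u) \<partial>time_measure 1) \<partial>time_measure 1)"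
    using t by (intro nn_integral_time_measure_scale) measurable
  also have "(\<integral>\<^sup>+u. ennreal t * (\<integral>\<^sup>+v. indicator {t * u<..} (t * v) * heat A (t * v - t * u) \<partial>time_measure 1) \<partial>time_measure 1)
     = ennreal t * (\<integral>\<^sup>+u. (\<integral>\<^sup>+v. indicator {t * u<..} (t * v) * heat A (t * v - t * u) \<partial>time_measure 1) \<partial>time_measure 1)"
    by (intro nn_integral_cmult) measurable
  also have "(\<integral>\<^sup>+u. (\<integral>\<^sup>+v. indicator {t * u<..} (t * v) * heat A (t * v - t * u) \<partial>time_measure 1) \<partial>time_measure 1) = heat_avg A t"
    using t by (simp add: heat_avg_def indicator_def right_diff_distrib)
  finally have eq: "(\<integral>\<^sup>+u. \<integral>\<^sup>+v. indicator {u<..} v * heat A (v - u) \<partial>time_measure t \<partial>time_measure t)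
     = ennreal t * (ennreal t * heat_avg A t)" .
  show ?thesis
    unfolding total_2[OF t A] unfolding eq using t by (simp add: power2_eq_square ennreal_mult mult.assoc)
qed

text \<open>For the constant function 1, \<open>nn_integral_square_symmetric\<close> says that the
  triangle is half of the unit square.\<close>

lemma nn_integral_triangle:
  "(\<integral>\<^sup>+u. \<integral>\<^sup>+v. indicator {u<..} v * c \<partial>time_measure 1 \<partial>time_measure 1) = c / 2"
proof -
  interpret T: finite_measure "time_measure 1" by (rule finite_measure_time_measure)
  note [measurable] = measurable_indicator_greaterThan
  let ?I = "\<integral>\<^sup>+u. \<integral>\<^sup>+v. indicator {u<..} v \<partial>time_measure 1 \<partial>time_measure 1 :: ennreal"
  have "(\<integral>\<^sup>+u. 1 \<partial>time_measure 1) = (1 :: ennreal)"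
    by (simp add: time_measure_def emeasure_restrict_space space_restrict_space)
  then have "1 = 2 * ?I"
    using nn_integral_square_symmetric[of "time_measure 1" "\<lambda>_. 1"]
    by (simp add: AE_time_measure_neq T.sigma_finite_measure_axioms)
  then have "2 * (?I * c) = c" by (simp add: mult.assoc[symmetric])
  then have "c / 2 = 2 * (?I * c) / 2" by simp
  also have "\<dots> = ?I * c"
    using mult_divide_eq_ennreal[of 2 "?I * c"] by (simp add: mult.commute)
  also have "\<dots> = (\<integral>\<^sup>+u. \<integral>\<^sup>+v. indicator {u<..} v * c \<partial>time_measure 1 \<partial>time_measure 1)"
    by (simp add: nn_integral_multc)
  finally show ?thesis ..
qed

text \<open>The upper bound is \<open>heat_le\<close> integrated over the triangle. The lower one is
  Fatou on the triangle, where \<open>heat_tendsto\<close> applies at each pair u < v because v - u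
  is a fixed positive factor.\<close>

lemma heat_avg_tendsto:
  assumes A [measurable]: "A \<in> sets borel" and a: "\<And>n. 0 < a n" "a \<longlonglongrightarrow> 0"
  shows "(\<lambda>n. heat_avg A (a n)) \<longlonglongrightarrow> emeasure lborel A / 2"
proof (rule tendsto_if_le_liminf)
  interpret T: finite_measure "time_measure 1" by (rule finite_measure_time_measure)
  note [measurable] = measurable_indicator_greaterThan
  show "heat_avg A (a n) \<le> emeasure lborel A / 2" for n
    unfolding heat_avg_def nn_integral_triangle[symmetric] using a(1)[of n]
    by (intro nn_integral_mono) (auto simp: indicator_def intro!: heat_le A)
  let ?f = "\<lambda>n w. indicator {fst w<..} (snd w) * heat A (a n * (snd w - fst w))"
  have "emeasure lborel A / 2 = (\<integral>\<^sup>+w. indicator {fst w<..} (snd w) * emeasure lborel A \<partial>(time_measure 1 \<Otimes>\<^sub>M time_measure 1))"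
    unfolding nn_integral_triangle[symmetric] by (subst T.nn_integral_fst[symmetric]) auto
  also have "\<dots> \<le> (\<integral>\<^sup>+w. liminf (\<lambda>n. ?f n w) \<partial>(time_measure 1 \<Otimes>\<^sub>M time_measure 1))"
  proof (rule nn_integral_mono)
    fix w :: "real \<times> real"
    show "indicator {fst w<..} (snd w) * emeasure lborel A \<le> liminf (\<lambda>n. ?f n w)"
    proof (cases "fst w < snd w")
      case True
      have "(\<lambda>n. a n * (snd w - fst w)) \<longlonglongrightarrow> 0"
        using tendsto_mult_right[OF a(2)] by simp
      then have "(\<lambda>n. heat A (a n * (snd w - fst w))) \<longlonglongrightarrow> emeasure lborel A"
        using True a(1) by (intro heat_tendsto) auto
      then show ?thesis using True by (simp add: lim_imp_Liminf)
    qed simp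
  qed
  also have "\<dots> \<le> liminf (\<lambda>n. \<integral>\<^sup>+w. ?f n w \<partial>(time_measure 1 \<Otimes>\<^sub>M time_measure 1))"
    by (rule nn_integral_liminf) measurable
  also have "\<dots> = liminf (\<lambda>n. heat_avg A (a n))"
    unfolding heat_avg_def by (subst T.nn_integral_fst[symmetric]) auto
  finally show "emeasure lborel A / 2 \<le> liminf (\<lambda>n. heat_avg A (a n))" .
qed

end

section \<open>Taylor formula and passage from nonnegative to real integrals\<close>

text \<open>Lagrange form of the third-order remainder of exp at -l, with c the negative of the
  intermediate point. That point lies strictly between -l and 0, so l = 0 is treated apart.\<close>

lemma exp_minus_Taylor_3:
  fixes l :: real
  assumes "0 \<le> l"
  obtains c where "0 \<le> c" "c \<le> l" "1 - exp (- l) - l + l\<^sup>2 / 2 = exp (- c) * l ^ 3 / 6"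
proof (cases "l = 0")
  case True
  then show ?thesis using that[of 0] by simp
next
  case False
  have "\<exists>t>- l. t < 0 \<and> exp (- l) = (\<Sum>m<3. exp 0 / fact m * (- l) ^ m) + exp t / fact 3 * (- l) ^ 3"
    using False assms by (intro Maclaurin_minus[where diff = "\<lambda>_. exp"]) (auto intro!: derivative_eq_intros)
  then obtain t where t: "- l < t" "t < 0" "exp (- l) = (\<Sum>m<3. exp 0 / fact m * (- l) ^ m) + exp t / fact 3 * (- l) ^ 3"
    by auto
  then show ?thesis
    using that[of "- t"] by (simp add: eval_nat_numeral field_simps)
qed

lemma integral_eq_enn2real_nn_integral:
  fixes f :: "'b \<Rightarrow> real"
  assumes "f \<in> borel_measurable M" "\<And>x. x \<in> space M \<Longrightarrow> ennreal (f x) = g x" "\<And>x. x \<in> space M \<Longrightarrow> 0 \<le> f x"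
  shows "integral\<^sup>L M f = enn2real (\<integral>\<^sup>+x. g x \<partial>M)"
proof -
  have "integral\<^sup>L M f = enn2real (\<integral>\<^sup>+x. ennreal (f x) \<partial>M)"
    using assms by (intro integral_eq_nn_integral) auto
  also have "(\<integral>\<^sup>+x. ennreal (f x) \<partial>M) = (\<integral>\<^sup>+x. g x \<partial>M)"
    using assms by (intro nn_integral_cong) auto
  finally show ?thesis .
qed

text \<open>Three functions occur because the integrand \<open>f\<close> is controlled on (u, 1)
  only: there it agrees with a globally Borel \<open>h\<close>, whose \<open>ennreal\<close> value
  is \<open>g\<close>.\<close>

lemma LBINT_eq_enn2real_nn_integral:
  fixes f :: "real \<Rightarrow> real"
  assumes "u \<le> 1" and [measurable]: "h \<in> borel_measurable borel"
    and "\<And>v. u < v \<Longrightarrow> v < 1 \<Longrightarrow> f v = h v" "\<And>v. u < v \<Longrightarrow> v < 1 \<Longrightarrow> ennreal (h v) = g v" "\<And>v. u < v \<Longrightarrow> v < 1 \<Longrightarrow> 0 \<le> h v"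
  shows "(LBINT v=u..1. f v) = enn2real (\<integral>\<^sup>+v. indicator {u<..<1} v * g v \<partial>lborel)"
proof -
  have "(LBINT v=u..1. f v) = (LBINT v:{u<..<1}. f v)"
    using assms(1) interval_integral_Ioo[of "ereal u" 1 f] by simp
  also have "\<dots> = (LBINT v:{u<..<1}. h v)"
    using assms(3) by (intro set_lebesgue_integral_cong) auto
  also have "\<dots> = enn2real (\<integral>\<^sup>+v. indicator {u<..<1} v * g v \<partial>lborel)"
    unfolding set_lebesgue_integral_def
    using assms(4,5) by (intro integral_eq_enn2real_nn_integral) (auto simp: indicator_def)
  finally show ?thesis .
qed

context stable_bridge_family
begin

text \<open>The integrands are nonnegative, and the inner integral is at most the mass 1 of the
  density, so \<open>enn2real\<close> loses nothing before the outer integral is taken.\<close>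

lemma heat_content_eq:
  assumes [measurable]: "A \<in> sets borel" and a: "0 < a"
  shows "heat_content \<alpha> A a = enn2real (heat A a)"
proof -
  let ?g = "\<lambda>x. \<integral>\<^sup>+y. indicator A x * indicator A y * ennreal (p a (x - y)) \<partial>lborel"
  have g_fin: "?g x < top" for x
  proof -
    have "?g x \<le> (\<integral>\<^sup>+y. ennreal (p a (x - y)) \<partial>lborel)"
      by (intro nn_integral_mono) (auto simp: indicator_def)
    then show ?thesis using a by (simp add: nn_integral_p_right le_less_trans[OF _ ennreal_one_less_top])
  qed
  have inner: "(\<integral>y. indicator A x * indicator A y * p a (x - y) \<partial>lebesgue) = enn2real (?g x)" for x
    using a by (subst integral_completion, measurable, intro integral_eq_enn2real_nn_integral)
      (auto simp: indicator_def p_nonneg)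
  have "heat_content \<alpha> A a = (\<integral>x. enn2real (?g x) \<partial>lebesgue)"
    by (simp add: heat_content_def inner)
  also have "\<dots> = enn2real (heat A a)"
    unfolding heat_def using g_fin
    by (subst integral_completion, measurable, intro integral_eq_enn2real_nn_integral)
      (auto simp: ennreal_enn2real)
  finally show ?thesis .
qed

text \<open>Subtraction is avoided until the end: deficit plus heat content is the constant |A|, so
  their integrals over the triangle add up to |A|/2 in \<open>ennreal\<close>. Finiteness of this
  sum then permits the difference in the reals.\<close>

lemma heat_deficit_integral:
  assumes A [measurable]: "A \<in> sets borel" and fin: "emeasure lborel A < \<infinity>" and t: "0 < t"
  shows "(LBINT l1=0..1. (LBINT l2=l1..1. measure lborel A - heat_content \<alpha> A (t * (l2 - l1))))
    = measure lborel A / 2 - enn2real (heat_avg A t)"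
proof -
  interpret T: finite_measure "time_measure 1" by (rule finite_measure_time_measure)
  note [measurable] = measurable_indicator_greaterThan
  define g where "g a = measure lborel A - enn2real (heat A a)" for a
  have [measurable]: "g \<in> borel_measurable borel" unfolding g_def by measurable
  have emA: "emeasure lborel A = ennreal (measure lborel A)"
    using fin by (simp add: emeasure_eq_ennreal_measure)
  have heat_fin: "heat A a < top" if "0 < a" for a
    using heat_le[OF A that] fin by (auto intro: le_less_trans)
  have g_nonneg: "0 \<le> g a" if "0 < a" for a
    using heat_le[OF A that] heat_fin[OF that] unfolding emA g_def
    by (simp add: enn2real_leI)
  have g_sum: "ennreal (g a) + heat A a = emeasure lborel A" if "0 < a" for a
  proof -
    have "ennreal (g a) + heat A a = ennreal (g a) + ennreal (enn2real (heat A a))"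
      using heat_fin[OF that] by simp
    also have "\<dots> = ennreal (measure lborel A)"
      using g_nonneg[OF that] by (subst ennreal_plus[symmetric]) (auto simp: g_def)
    finally show ?thesis by (simp add: emA)
  qed
  have g_le: "ennreal (g a) \<le> emeasure lborel A" if "0 < a" for a
    using g_sum[OF that] by (metis le_iff_add)
  have g_eq: "measure lborel A - heat_content \<alpha> A a = g a" if "0 < a" for a
    using that by (simp add: g_def heat_content_eq)
  define G where "G u = (\<integral>\<^sup>+v. indicator {u<..} v * ennreal (g (t * (v - u))) \<partial>time_measure 1)" for u
  have [measurable]: "G \<in> borel_measurable borel" unfolding G_def by measurable
  have time_integral: "(\<integral>\<^sup>+v. indicator {u<..<1} v * ennreal (f v) \<partial>lborel) = (\<integral>\<^sup>+v. indicator {u<..} v * ennreal (f v) \<partial>time_measure 1)"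
    if [measurable]: "f \<in> borel_measurable borel" and "0 \<le> u" for u f
    using \<open>0 \<le> u\<close> by (subst nn_integral_time_measure) (auto intro!: nn_integral_cong simp: indicator_def)
  have G_fin: "G u < top" if "0 \<le> u" for u
  proof -
    have "G u \<le> (\<integral>\<^sup>+v. emeasure lborel A \<partial>time_measure 1)"
      unfolding G_def
      using t g_le by (intro nn_integral_mono) (auto simp: indicator_def)
    also have "\<dots> < top"
      using fin by (simp add: time_measure_def emeasure_restrict_space space_restrict_space)
    finally show ?thesis .
  qed
  have inner: "(LBINT v=u..1. measure lborel A - heat_content \<alpha> A (t * (v - u))) = enn2real (G u)" if "0 < u" "u < 1" for u
  proof -
    have "(LBINT v=u..1. measure lborel A - heat_content \<alpha> A (t * (v - u)))
       = enn2real (\<integral>\<^sup>+v. indicator {u<..<1} v * ennreal (g (t * (v - u))) \<partial>lborel)"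
      using that t by (intro LBINT_eq_enn2real_nn_integral[where h = "\<lambda>v. g (t * (v - u))"]) (auto simp: g_eq g_nonneg)
    then show ?thesis using that by (simp add: G_def time_integral)
  qed
  have "(LBINT l1=0..1. (LBINT l2=l1..1. measure lborel A - heat_content \<alpha> A (t * (l2 - l1))))
     = enn2real (\<integral>\<^sup>+u. indicator {0<..<1} u * G u \<partial>lborel)"
    using inner G_fin LBINT_eq_enn2real_nn_integral[of 0 "\<lambda>u. enn2real (G u)" "\<lambda>l1. LBINT l2=l1..1. measure lborel A - heat_content \<alpha> A (t * (l2 - l1))" G]
    by (simp add: zero_ereal_def[symmetric])
  also have "(\<integral>\<^sup>+u. indicator {0<..<1} u * G u \<partial>lborel) = (\<integral>\<^sup>+u. G u \<partial>time_measure 1)"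
    by (subst nn_integral_time_measure) (auto simp: mult.commute)
  finally have *: "(LBINT l1=0..1. (LBINT l2=l1..1. measure lborel A - heat_content \<alpha> A (t * (l2 - l1))))
     = enn2real (\<integral>\<^sup>+u. G u \<partial>time_measure 1)" .
  have "(\<integral>\<^sup>+u. G u \<partial>time_measure 1) + heat_avg A t
     = (\<integral>\<^sup>+u. (\<integral>\<^sup>+v. indicator {u<..} v * emeasure lborel A \<partial>time_measure 1) \<partial>time_measure 1)"
    unfolding heat_avg_def G_def using t
    by (subst nn_integral_add[symmetric], measurable, intro nn_integral_cong, subst nn_integral_add[symmetric])
       (auto intro!: nn_integral_cong simp: indicator_def g_sum)
  also have "\<dots> = ennreal (measure lborel A / 2)"
    unfolding nn_integral_triangle emA using divide_ennreal[of "measure lborel A" 2] by simp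
  finally have sum: "(\<integral>\<^sup>+u. G u \<partial>time_measure 1) + heat_avg A t = ennreal (measure lborel A / 2)" .
  then have "(\<integral>\<^sup>+u. G u \<partial>time_measure 1) < top" "heat_avg A t < top"
    by (metis ennreal_add_less_top ennreal_less_top)+
  with sum have "enn2real (\<integral>\<^sup>+u. G u \<partial>time_measure 1) + enn2real (heat_avg A t) = measure lborel A / 2"
    by (subst enn2real_plus[symmetric]) simp_all
  then show ?thesis using * by simp
qed

section \<open>The expansion, the bounds and the cubic limit\<close>

definition remainder :: "real \<Rightarrow> real" where
  "remainder l = 1 - exp (- l) - l + l\<^sup>2 / 2"

lemma remainder_bounds:
  assumes "0 \<le> l"
  shows "exp (- l) * l ^ 3 / 6 \<le> remainder l" "remainder l \<le> l ^ 3 / 6" "0 \<le> remainder l"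
proof -
  obtain c where c: "0 \<le> c" "c \<le> l" "remainder l = exp (- c) * l ^ 3 / 6"
    using exp_minus_Taylor_3[OF assms] unfolding remainder_def by metis
  show "exp (- l) * l ^ 3 / 6 \<le> remainder l" "0 \<le> remainder l"
    unfolding c(3) using c(1,2) assms by (auto intro!: divide_right_mono mult_right_mono)
  have "exp (- c) * l ^ 3 \<le> 1 * l ^ 3"
    using c(1) assms by (intro mult_right_mono) auto
  then show "remainder l \<le> l ^ 3 / 6" unfolding c(3) by simp
qed

text \<open>Boundedness of f would not suffice, since the endpoints range over a space of infinite
  measure. A bound by c l compares with the first moment, which is t |A|.\<close>

lemma total_finite:
  assumes t: "0 < t" and A: "A \<in> sets borel" and fin: "emeasure lborel A < \<infinity>"
    and le: "\<And>l. 0 \<le> l \<Longrightarrow> l \<le> t \<Longrightarrow> f l \<le> c * l" and c: "0 \<le> c"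
  shows "total t A f < top"
proof -
  have "total t A f \<le> total t A (\<lambda>l. c * l)" using t le by (rule total_mono)
  also have "\<dots> = ennreal c * (ennreal t * emeasure lborel A)"
    using total_cmult[of t A "\<lambda>l. l" c] total_measurable_power[of t A 1] t A c by (simp add: total_1)
  also have "\<dots> < top" using fin by (simp add: ennreal_mult_less_top)
  finally show ?thesis .
qed

text \<open>The last three claims integrate pointwise inequalities on [0, t]. In
  \<open>?cubic\<close> the factor 4 combines the 2 of 2 t l^2 with the 2 of T_2 = 2 t^2
  \<open>heat_avg\<close>.\<close>

lemma total_expansion:
  assumes A: "A \<in> sets borel" and fin: "emeasure lborel A < \<infinity>" and t: "0 < t"
  shows "enn2real (total t A (\<lambda>l. 1 - exp (- l))) + t\<^sup>2 * enn2real (heat_avg A t)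
      = t * measure lborel A + enn2real (total t A remainder)" (is ?eq)
    and "enn2real (total t A remainder) \<le> measure lborel A / 6 * t ^ 3" (is ?upper)
    and "exp (- t) / 6 * enn2real (total t A (\<lambda>l. l ^ 3)) \<le> enn2real (total t A remainder)" (is ?lower)
    and "4 * t ^ 3 * enn2real (heat_avg A t) \<le> enn2real (total t A (\<lambda>l. l ^ 3)) + t ^ 3 * measure lborel A" (is ?cubic)
proof -
  let ?a = "measure lborel A"
  have emA: "emeasure lborel A = ennreal ?a"
    using fin by (simp add: emeasure_eq_ennreal_measure)
  have [measurable]: "remainder \<in> borel_measurable borel" unfolding remainder_def by measurable
  note tm = t A
  have m1: "total_measurable t A (\<lambda>l. l)" using total_measurable_power[OF tm, of 1] by simp
  note m2 = total_measurable_power[OF tm, of 2] and m3 = total_measurable_power[OF tm, of 3]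
  have m2': "total_measurable t A (\<lambda>l. 1 / 2 * l\<^sup>2)" using m2 tm by (intro total_measurable_cmult) auto
  \<comment> \<open>The sum of exp(-l) and 1 - exp(-l) is 1, the zeroth moment, and exp(-l) is
    bounded by 1.\<close>
  have mE: "total_measurable t A (\<lambda>l. 1 - exp (- l))"
    by (rule total_measurable_cancel[of t A "\<lambda>l. exp (- l)" _ 1])
      (use tm total_measurable_exp[OF tm] total_measurable_power[OF tm, of 0] in auto)
  have split: "(\<lambda>l. (1 - exp (- l)) + 1 / 2 * l\<^sup>2) = (\<lambda>l. l + remainder l)"
    by (auto simp: remainder_def)
  have mS: "total_measurable t A (\<lambda>l. l + remainder l)"
    unfolding split[symmetric] using tm mE m2' by (intro total_measurable_add) auto
  \<comment> \<open>Cancel l, bounded by t, from the sum l + r(l), which is measurable through its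
    other form.\<close>
  have mR: "total_measurable t A remainder"
    by (rule total_measurable_cancel[of t A "\<lambda>l. l" _ t])
      (use tm m1 mS remainder_bounds in auto)
  have T1: "total t A (\<lambda>l. l) = ennreal (t * ?a)"
    using total_1[OF tm] t by (simp add: emA ennreal_mult')
  have T2: "total t A (\<lambda>l. l\<^sup>2) = 2 * ennreal (t\<^sup>2) * heat_avg A t" using total_2_heat_avg[OF tm] .
  have T2_fin: "total t A (\<lambda>l. l\<^sup>2) < top"
    using t by (intro total_finite[OF tm fin, of _ t]) (auto simp: power2_eq_square intro: mult_right_mono)
  \<comment> \<open>This turns cubic bounds into the linear ones required by
    \<open>total_finite\<close>, and also yields the constant |A|/6 in
    \<open>?upper\<close>.\<close>
  have T3_le: "l ^ 3 \<le> t\<^sup>2 * l" if "0 \<le> l" "l \<le> t" for l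
    using that mult_right_mono[OF power_mono[of l t 2], of l] by (simp add: eval_nat_numeral)
  have T3_fin: "total t A (\<lambda>l. l ^ 3) < top"
    using T3_le by (intro total_finite[OF tm fin, of _ "t\<^sup>2"]) auto
  have R_fin: "total t A remainder < top"
    using T3_le remainder_bounds(2) by (intro total_finite[OF tm fin, of _ "t\<^sup>2 / 6"]) fastforce+
  have E_fin: "total t A (\<lambda>l. 1 - exp (- l)) < top"
    by (intro total_finite[OF tm fin, of _ 1]) (use exp_ge_add_one_self[of "- _"] in \<open>auto simp: algebra_simps\<close>)
  have half: "total t A (\<lambda>l. 1 / 2 * l\<^sup>2) = ennreal (1 / 2) * total t A (\<lambda>l. l\<^sup>2)"
    using tm m2 by (intro total_cmult) auto
  have T2_real: "enn2real (total t A (\<lambda>l. l\<^sup>2)) = 2 * t\<^sup>2 * enn2real (heat_avg A t)"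
    unfolding T2 by (simp add: enn2real_mult)
  have "total t A (\<lambda>l. 1 - exp (- l)) + ennreal (1 / 2) * total t A (\<lambda>l. l\<^sup>2) = total t A (\<lambda>l. l) + total t A remainder"
  proof -
    have "total t A (\<lambda>l. (1 - exp (- l)) + 1 / 2 * l\<^sup>2) = total t A (\<lambda>l. 1 - exp (- l)) + total t A (\<lambda>l. 1 / 2 * l\<^sup>2)"
      using tm mE m2' by (intro total_add) auto
    moreover have "total t A (\<lambda>l. l + remainder l) = total t A (\<lambda>l. l) + total t A remainder"
      using tm m1 mR remainder_bounds(3) by (intro total_add) auto
    ultimately show ?thesis unfolding half split by simp
  qed
  then have eq: "enn2real (total t A (\<lambda>l. 1 - exp (- l)) + ennreal (1 / 2) * total t A (\<lambda>l. l\<^sup>2)) = enn2real (total t A (\<lambda>l. l) + total t A remainder)"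
    by simp
  have enn2real_half: "enn2real (ennreal (1 / 2)) = 1 / 2"
    by (rule enn2real_ennreal) simp
  have "ennreal (1 / 2) * total t A (\<lambda>l. l\<^sup>2) < top"
    using T2_fin by (simp only: ennreal_mult_less_top ennreal_less_top simp_thms)
  then have "enn2real (total t A (\<lambda>l. 1 - exp (- l)) + ennreal (1 / 2) * total t A (\<lambda>l. l\<^sup>2))
      = enn2real (total t A (\<lambda>l. 1 - exp (- l))) + t\<^sup>2 * enn2real (heat_avg A t)"
    by (simp only: enn2real_plus[OF E_fin] enn2real_mult T2_real enn2real_half)
  moreover have "enn2real (total t A (\<lambda>l. l) + total t A remainder) = t * ?a + enn2real (total t A remainder)"
    using t R_fin unfolding T1 by (subst enn2real_plus) auto
  ultimately show ?eq using eq by argo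
  have "total t A remainder \<le> total t A (\<lambda>l. t\<^sup>2 / 6 * l)"
    using t T3_le remainder_bounds(2) by (intro total_mono) fastforce+
  also have "\<dots> = ennreal (t\<^sup>2 / 6) * total t A (\<lambda>l. l)"
    using tm m1 by (intro total_cmult) auto
  also have "\<dots> = ennreal (?a / 6 * t ^ 3)"
    unfolding T1 using t by (simp add: ennreal_mult'[symmetric] eval_nat_numeral mult_ac)
  finally show ?upper
    using t by (intro enn2real_leI) auto
  have "ennreal (exp (- t) / 6) * total t A (\<lambda>l. l ^ 3) = total t A (\<lambda>l. exp (- t) / 6 * l ^ 3)"
    using tm m3 by (intro total_cmult[symmetric]) auto
  also have "\<dots> \<le> total t A remainder"
  proof (rule total_mono[OF t])
    fix l assume l: "0 \<le> l" "l \<le> t"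
    have "exp (- t) / 6 * l ^ 3 \<le> exp (- l) / 6 * l ^ 3"
      using l by (intro mult_right_mono divide_right_mono) auto
    then show "exp (- t) / 6 * l ^ 3 \<le> remainder l" using remainder_bounds(1)[OF l(1)] by simp
  qed
  finally have "enn2real (ennreal (exp (- t) / 6) * total t A (\<lambda>l. l ^ 3)) \<le> enn2real (total t A remainder)"
    using R_fin by (intro enn2real_mono) auto
  then show ?lower by (simp add: enn2real_mult)
  have "ennreal (2 * t) * total t A (\<lambda>l. l\<^sup>2) = total t A (\<lambda>l. 2 * t * l\<^sup>2)"
    using tm m2 by (intro total_cmult[symmetric]) auto
  also have "\<dots> \<le> total t A (\<lambda>l. l ^ 3 + t\<^sup>2 * l)"
  proof (rule total_mono[OF t])
    fix l assume l: "0 \<le> l" "l \<le> t"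
    have "0 \<le> l * (t - l)\<^sup>2" using l by simp
    then show "2 * t * l\<^sup>2 \<le> l ^ 3 + t\<^sup>2 * l" by (simp add: power2_eq_square eval_nat_numeral algebra_simps)
  qed
  also have "\<dots> = total t A (\<lambda>l. l ^ 3) + total t A (\<lambda>l. t\<^sup>2 * l)"
    using tm m3 m1 by (intro total_add total_measurable_cmult) auto
  also have "total t A (\<lambda>l. t\<^sup>2 * l) = ennreal (t ^ 3 * ?a)"
    using total_cmult[of t A "\<lambda>l. l" "t\<^sup>2"] tm m1 T1 by (simp add: ennreal_mult'[symmetric] eval_nat_numeral mult_ac)
  finally have "enn2real (ennreal (2 * t) * total t A (\<lambda>l. l\<^sup>2)) \<le> enn2real (total t A (\<lambda>l. l ^ 3) + ennreal (t ^ 3 * ?a))"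
    using T3_fin by (intro enn2real_mono) auto
  also have "\<dots> = enn2real (total t A (\<lambda>l. l ^ 3)) + t ^ 3 * ?a"
    using T3_fin t by (subst enn2real_plus) auto
  finally show ?cubic
    using t unfolding enn2real_mult T2_real by (simp add: power2_eq_square power3_eq_cube mult_ac)
qed

text \<open>The upper side of the sandwich is the constant |A|/6. On the lower side
  \<open>?lower\<close> and \<open>?cubic\<close> give exp(-t)/6 times (4 \<open>heat_avg\<close> -
  |A|), and \<open>heat_avg\<close> tends to |A|/2, so the bracket tends to 2|A| - |A|.\<close>

lemma total_remainder_limit:
  assumes A: "A \<in> sets borel" and fin: "emeasure lborel A < \<infinity>"
  shows "((\<lambda>t. enn2real (total t A remainder) / t ^ 3) \<longlongrightarrow> measure lborel A / 6) (at_right 0)"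
proof (rule tendsto_at_right_sequentially[OF zero_less_one])
  fix S :: "nat \<Rightarrow> real" assume S: "\<And>n. 0 < S n" "S \<longlonglongrightarrow> 0"
  have emA: "emeasure lborel A / 2 = ennreal (measure lborel A / 2)"
    using fin divide_ennreal[of "measure lborel A" 2] by (simp add: emeasure_eq_ennreal_measure)
  have avg: "(\<lambda>n. enn2real (heat_avg A (S n))) \<longlonglongrightarrow> measure lborel A / 2"
    using heat_avg_tendsto[OF A S] unfolding emA by (intro tendsto_enn2real) auto
  show "(\<lambda>n. enn2real (total (S n) A remainder) / S n ^ 3) \<longlonglongrightarrow> measure lborel A / 6"
  proof (rule tendsto_sandwich)
    have "(\<lambda>n. exp (- S n) / 6 * (4 * enn2real (heat_avg A (S n)) - measure lborel A))
        \<longlonglongrightarrow> exp (- 0) / 6 * (4 * (measure lborel A / 2) - measure lborel A)"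
      by (intro tendsto_intros S avg) auto
    then show "(\<lambda>n. exp (- S n) / 6 * (4 * enn2real (heat_avg A (S n)) - measure lborel A)) \<longlonglongrightarrow> measure lborel A / 6"
      by simp
    show "(\<lambda>n. measure lborel A / 6) \<longlonglongrightarrow> measure lborel A / 6" by simp
    show "\<forall>\<^sub>F n in sequentially. enn2real (total (S n) A remainder) / S n ^ 3 \<le> measure lborel A / 6"
      using total_expansion(2)[OF A fin S(1)] S(1) by (intro always_eventually allI) (simp add: pos_divide_le_eq)
    show "\<forall>\<^sub>F n in sequentially. exp (- S n) / 6 * (4 * enn2real (heat_avg A (S n)) - measure lborel A) \<le> enn2real (total (S n) A remainder) / S n ^ 3"
    proof (intro always_eventually allI)
      fix n
      have "exp (- S n) / 6 * (4 * S n ^ 3 * enn2real (heat_avg A (S n)) - S n ^ 3 * measure lborel A)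
        \<le> exp (- S n) / 6 * enn2real (total (S n) A (\<lambda>l. l ^ 3))"
        using total_expansion(4)[OF A fin S(1)[of n]] by (intro mult_left_mono) auto
      also have "\<dots> \<le> enn2real (total (S n) A remainder)"
        by (rule total_expansion(3)[OF A fin S(1)])
      finally show "exp (- S n) / 6 * (4 * enn2real (heat_avg A (S n)) - measure lborel A) \<le> enn2real (total (S n) A remainder) / S n ^ 3"
        using S(1)[of n] by (subst pos_le_divide_eq) (auto simp: algebra_simps)
    qed
  qed
qed

section \<open>Replacing a Lebesgue set by a Borel one\<close>

text \<open>The first occupation moment of N is an integral over a null set, so almost every bridge
  path spends zero time in N. Along such a path the indicators of \<Omega> and A agree at almost all
  times, and equal integrals follow even if the indicator of \<Omega> along the path is not
  measurable.\<close>

lemma total_cong_null: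
  assumes t: "0 < t" and A [measurable]: "A \<in> sets borel" and N: "N \<in> null_sets lborel"
    and sub: "A \<subseteq> \<Omega>" "\<Omega> - A \<subseteq> N"
  shows "total t \<Omega> f = total t A f"
proof -
  have [measurable]: "N \<in> sets borel" using N by auto
  interpret T: finite_measure "time_measure t" by (rule finite_measure_time_measure)
  have "AE \<omega> in B t x y. occupation_time \<Omega> t (X t x y \<omega>) = occupation_time A t (X t x y \<omega>)" for x y
  proof -
    have "AE z in lborel. z \<notin> N" using N by (rule AE_not_in)
    then have "AE z in lborel. indicator N z * (ennreal (p u (x - z)) * ennreal (p (t - u) (z - y))) = 0" for u
      by (rule eventually_mono) simp
    then have "(\<integral>\<^sup>+z. indicator N z * (ennreal (p u (x - z)) * ennreal (p (t - u) (z - y))) \<partial>lborel) = 0" for u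
      by (subst nn_integral_0_iff_AE) measurable
    moreover have "occ_moment t N 1 x y = (\<integral>\<^sup>+u. \<integral>\<^sup>+z. indicator N z * (ennreal (p u (x - z)) * ennreal (p (t - u) (z - y))) \<partial>lborel \<partial>time_measure t)"
      unfolding occ_moment_1[OF t \<open>N \<in> sets borel\<close>] case_prod_beta' by (subst lborel.nn_integral_fst[symmetric]) auto
    ultimately have "occ_moment t N 1 x y = 0" by simp
    then have "(\<integral>\<^sup>+\<omega>. occ t x y N \<omega> \<partial>B t x y) = 0"
      using p_pos[OF t, of "x - y"] by (simp add: occ_moment_def)
    then have "AE \<omega> in B t x y. occ t x y N \<omega> = 0"
      using measurable_occ[OF t] by (subst (asm) nn_integral_0_iff_AE) auto
    then show ?thesis
      using AE_space
    proof eventually_elim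
      case (elim \<omega>)
      have [measurable]: "(\<lambda>s. X t x y \<omega> s) \<in> borel_measurable (time_measure t)"
        using measurable_Pair2[OF measurable_X_time_measure[OF t] elim(2)] by simp
      have "AE s in time_measure t. indicator N (X t x y \<omega> s) = (0 :: ennreal)"
        using elim(1) unfolding occ_def by (subst (asm) nn_integral_0_iff_AE) auto
      then have "occ t x y \<Omega> \<omega> = occ t x y A \<omega>"
        unfolding occ_def using sub by (intro nn_integral_cong_AE) (auto elim!: eventually_mono simp: indicator_def split: if_splits)
      then show ?case by (simp add: occupation_time_eq)
    qed
  qed
  then have "AE \<omega> in B t x y. ennreal (f (occupation_time \<Omega> t (X t x y \<omega>))) = ennreal (f (occupation_time A t (X t x y \<omega>)))" for x y
    by (rule eventually_mono) simp
  then have "(\<integral>\<^sup>+\<omega>. ennreal (f (occupation_time \<Omega> t (X t x y \<omega>))) \<partial>B t x y) = (\<integral>\<^sup>+\<omega>. ennreal (f (occupation_time A t (X t x y \<omega>))) \<partial>B t x y)" for x y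
    by (rule nn_integral_cong_AE)
  then show ?thesis by (simp add: total_def bridge_int_def)
qed

end

text \<open>The inner integrals agree for every x, the outer one for almost every x. The inner
  integral over A depends measurably on x because it equals its \<open>lborel\<close>
  version.\<close>

lemma heat_content_cong_null:
  fixes A \<Omega> :: "'a::euclidean_space set"
  assumes A [measurable]: "A \<in> sets borel" and \<Omega>: "\<Omega> \<in> sets lebesgue" and ae: "AE x in lebesgue. x \<in> \<Omega> \<longleftrightarrow> x \<in> A"
  shows "heat_content \<alpha> \<Omega> a = heat_content \<alpha> A a"
proof -
  let ?K = "\<lambda>x. \<integral>y. indicator A y * stable_density \<alpha> a (x - y) \<partial>lebesgue"
  have "?K x = (\<integral>y. indicator A y * stable_density \<alpha> a (x - y) \<partial>lborel)" for x
    by (intro integral_completion) measurable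
  moreover have "(\<lambda>x. \<integral>y. indicator A y * stable_density \<alpha> a (x - y) \<partial>lborel) \<in> borel_measurable lborel"
    by measurable
  ultimately have K [measurable]: "?K \<in> borel_measurable lebesgue"
    by (simp add: measurable_completion)
  have [measurable]: "(\<lambda>y. stable_density \<alpha> a (x - y)) \<in> borel_measurable lebesgue" for x :: 'a
    by (rule measurable_completion) measurable
  have [measurable]: "A \<in> sets lebesgue" using A by auto
  note [measurable] = \<Omega>
  have inner: "(\<integral>y. indicator \<Omega> x * indicator \<Omega> y * stable_density \<alpha> a (x - y) \<partial>lebesgue) = indicator \<Omega> x * ?K x" for x :: 'a
  proof -
    have "(\<integral>y. indicator \<Omega> y * stable_density \<alpha> a (x - y) \<partial>lebesgue) = ?K x"
      using ae by (intro integral_cong_AE) (auto elim!: eventually_mono simp: indicator_def)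
    then show ?thesis by (simp add: mult.assoc)
  qed
  have "heat_content \<alpha> \<Omega> a = (\<integral>x. indicator \<Omega> x * ?K x \<partial>lebesgue)"
    by (simp add: heat_content_def inner)
  also have "\<dots> = (\<integral>x. indicator A x * ?K x \<partial>lebesgue)"
  proof (rule integral_cong_AE)
    show "AE x in lebesgue. indicator \<Omega> x * ?K x = indicator A x * ?K x"
      using ae by (rule eventually_mono) (simp add: indicator_def)
  qed (intro borel_measurable_times K borel_measurable_indicator; measurable)+
  also have "\<dots> = heat_content \<alpha> A a"
    by (simp add: heat_content_def mult.assoc)
  finally show ?thesis .
qed

theorem theorem2p3:
  fixes \<alpha> :: real and \<Omega> :: "'a::euclidean_space set"
    and B :: "real \<Rightarrow> 'a \<Rightarrow> 'a \<Rightarrow> 'w measure"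
    and X :: "real \<Rightarrow> 'a \<Rightarrow> 'a \<Rightarrow> 'w \<Rightarrow> real \<Rightarrow> 'a"
  assumes "0 < \<alpha>" and "\<alpha> \<le> 2" and "2 \<le> DIM('a)"
    and "\<Omega> \<in> sets lebesgue" and "emeasure lebesgue \<Omega> < \<infinity>"
    and "\<And>t x y. 0 < t \<Longrightarrow> is_stable_bridge \<alpha> t x y (B t x y) (X t x y)"
  shows "\<exists>R :: real \<Rightarrow> real.
     (\<forall>t\<ge>0. 0 \<le> R t) \<and>
     (\<forall>t\<ge>0. stable_Psi \<alpha> \<Omega> B X t + t * (t / 2 - 1) * measure lebesgue \<Omega>
        = t ^ 2 * (LBINT l1=0..1. (LBINT l2=l1..1.
                     measure lebesgue \<Omega> - heat_content \<alpha> \<Omega> (t * (l2 - l1)))) + R t) \<and>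
     (\<forall>t\<ge>0. exp (- t) / fact 3 * stable_T 3 \<alpha> \<Omega> B X t \<le> R t
            \<and> R t \<le> measure lebesgue \<Omega> / fact 3 * t ^ 3) \<and>
     ((\<lambda>t. R t / t ^ 3) \<longlongrightarrow> measure lebesgue \<Omega> / fact 3) (at_right 0)"
proof -
  interpret stable_bridge_family \<alpha> B X
    using assms(1,6) by unfold_locales
  \<comment> \<open>A Borel set A inside \<Omega> whose complement in \<Omega> is covered by a Borel
    null set N.\<close>
  obtain A N' N where A: "\<Omega> = A \<union> N'" "N' \<subseteq> N" "N \<in> null_sets lborel" "A \<in> sets lborel"
    using assms(4) by (rule sets_completionE)
  have A_borel [simp]: "A \<in> sets borel" using A(4) by simp
  have A_lebesgue: "A \<in> sets lebesgue" using A_borel by auto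
  have ae: "AE x in lebesgue. x \<in> \<Omega> \<longleftrightarrow> x \<in> A"
    using AE_not_in[OF null_sets_completionI[OF A(3)]] by (rule eventually_mono) (use A(1,2) in auto)
  have em: "emeasure lebesgue \<Omega> = emeasure lborel A"
  proof -
    have "emeasure lebesgue \<Omega> = emeasure lebesgue A"
      using assms(4) A_lebesgue ae by (intro emeasure_eq_AE) auto
    then show ?thesis by simp
  qed
  have fin: "emeasure lborel A < \<infinity>" using assms(5) em by simp
  have meas: "measure lebesgue \<Omega> = measure lborel A" using em by (simp add: measure_def)
  have heat: "heat_content \<alpha> \<Omega> a = heat_content \<alpha> A a" for a
    using A_borel assms(4) ae by (rule heat_content_cong_null)
  have total: "total t \<Omega> f = total t A f" if "0 < t" for t f
    using that A_borel A(3) by (rule total_cong_null) (use A(1,2) in auto)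
  \<comment> \<open>At t = 0 nothing is known about \<open>B\<close> and \<open>X\<close>, but the
    occupation time is an integral over a single point, so \<Psi> and T vanish.\<close>
  have zero: "occupation_time \<Omega> 0 w = 0" for w
  proof -
    have "(\<integral>\<^sup>+s\<in>{0..0}. indicator \<Omega> (w s) \<partial>lborel) = (\<integral>\<^sup>+s. 0 \<partial>(lborel :: real measure))"
      using AE_lborel_singleton[of "0 :: real"] by (intro nn_integral_cong_AE) (auto elim!: eventually_mono)
    then show ?thesis by (simp add: occupation_time_def)
  qed
  have Psi0: "stable_Psi \<alpha> \<Omega> B X 0 = 0" by (simp add: stable_Psi_def zero)
  have T0: "stable_T 3 \<alpha> \<Omega> B X 0 = 0" by (simp add: stable_T_def zero)
  \<comment> \<open>The value 0 at t = 0 is forced by nonnegativity and the upper bound |\<Omega>|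
    t^3 / 6.\<close>
  define R where "R t = (if t = 0 then 0 else enn2real (total t A remainder))" for t :: real
  show ?thesis
  proof (intro exI[of _ R] conjI allI impI)
    fix t :: real assume "0 \<le> t"
    then consider "t = 0" | "0 < t" by linarith
    note cases = this
    show "0 \<le> R t" by (simp add: R_def)
    show "stable_Psi \<alpha> \<Omega> B X t + t * (t / 2 - 1) * measure lebesgue \<Omega>
        = t ^ 2 * (LBINT l1=0..1. (LBINT l2=l1..1.
                     measure lebesgue \<Omega> - heat_content \<alpha> \<Omega> (t * (l2 - l1)))) + R t"
    proof (cases rule: cases)
      case 1
      then show ?thesis by (simp add: Psi0 R_def)
    next
      case 2
      \<comment> \<open>The double integral equals |A|/2 - \<open>heat_avg\<close>, so the claim is
        \<Psi> + t^2 \<open>heat_avg\<close> = t |A| + R after cancelling t^2 |A| / 2.\<close>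
      show ?thesis
        unfolding stable_Psi_eq total[OF 2] meas heat heat_deficit_integral[OF A_borel fin 2]
        using total_expansion(1)[OF A_borel fin 2] 2 by (simp add: R_def power2_eq_square algebra_simps)
    qed
    show "exp (- t) / fact 3 * stable_T 3 \<alpha> \<Omega> B X t \<le> R t"
    proof (cases rule: cases)
      case 1
      then show ?thesis by (simp add: T0 R_def)
    next
      case 2
      then show ?thesis
        unfolding stable_T_eq total[OF 2]
        using total_expansion(3)[OF A_borel fin 2] by (simp add: R_def fact_numeral)
    qed
    show "R t \<le> measure lebesgue \<Omega> / fact 3 * t ^ 3"
    proof (cases rule: cases)
      case 1
      then show ?thesis by (simp add: R_def)
    next
      case 2
      then show ?thesis
        unfolding meas using total_expansion(2)[OF A_borel fin 2] by (simp add: R_def fact_numeral)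
    qed
  next
    have "((\<lambda>t. enn2real (total t A remainder) / t ^ 3) \<longlongrightarrow> measure lebesgue \<Omega> / fact 3) (at_right 0)"
      using total_remainder_limit[OF A_borel fin] by (simp add: meas fact_numeral)
    then show "((\<lambda>t. R t / t ^ 3) \<longlongrightarrow> measure lebesgue \<Omega> / fact 3) (at_right 0)"
      by (rule Lim_transform_eventually) (auto simp: R_def eventually_at_filter)
  qed
qed

end
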